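(* Let $1<q<\infty$ with $q\ne 2$, let $G$ be a finite bi-coloured multigraph, and let $(G,p)$ be a completely regular framework in $(\mathbb{R}^2,(\|\cdot\|_2,\|\cdot\|_q))$, with blue edges constraining the Euclidean distance and red edges constraining the $\|\cdot\|_q$-distance. Then $(G,p)$ is minimally infinitesimally rigid if and only if $G$ is $(2,2)$-tight and $(2,3)$-limited.
   Context: A bi-coloured multigraph $G=(V,E)$ is a finite loopless multigraph with nonempty vertex set, each of whose edges is coloured blue or red, with no two parallel edges of the same colour. $K(V)$ is the complete bi-coloured multigraph on $V$, with one blue and one red edge between each pair of distinct vertices. For $k\in\{2,3\}$, a multigraph is $(2,k)$-sparse if $|E'|\le 2|V'|-k$ for all subgraphs $(V',E')$ with $|E'|>0$ (parallel edges counted with multiplicity); it is $(2,k)$-tight if moreover $|E|=2|V|-k$. A bi-coloured multigraph is $(2,3)$-limited if every subgraph all of whose edges are blue is $(2,3)$-sparse. A framework $(G,p)$ is a bi-coloured multigraph with a placement $p:V\to\mathbb{R}^2$ with distinct joints $p(v)$. A blue edge $vw$ constrains $d_b(p(v),p(w))=\|p(v)-p(w)\|_2$ and a red edge $vw$ constrains $d_r(p(v),p(w))=\|p(v)-p(w)\|_q$. The rigidity matrix is the $|E|\times 2|V|$ Jacobian matrix at $p$ of the map sending a placement to its tuple of edge separations; its kernel is the space of infinitesimal flexes. $(G,p)$ is infinitesimally rigid if its rigidity matrix has rank $2|V|-2$ (equivalently the only infinitesimal flexes are the infinitesimal translations), and minimally infinitesimally rigid if moreover $(G-e,p)$ is not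 infinitesimally rigid for every edge $e$. $(G,p)$ is completely regular if for every subgraph $H$ of $K(V)$ the rigidity matrix of $(H,p|_H)$ has maximal rank over all placements of $H$. *)

theory Defs
  imports "HOL-Analysis.Analysis"
begin

datatype colour = Blue | Red

lemma UNIV_colour: "UNIV = {Blue, Red}"
  using colour.exhaust by auto

instance colour :: finite
  by standard (simp add: UNIV_colour)

text \<open>
  An edge is a colour together with its set of two endpoints, so parallel edges of the same
  colour and loops are excluded by the encoding. Vertices are drawn from an ambient finite type;
  the vertex set of a graph is an arbitrary nonempty subset of it.
\<close>

type_synonym 'v edge = "colour \<times> 'v set"

definition complete_edges :: "'v set \<Rightarrow> 'v edge set" where
  "complete_edges V = {(c, e). e \<subseteq> V \<and> card e = 2}"

definition bicoloured_multigraph :: "'v set \<Rightarrow> 'v edge set \<Rightarrow> bool" where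
  "bicoloured_multigraph V E \<longleftrightarrow> finite V \<and> V \<noteq> {} \<and> E \<subseteq> complete_edges V"

definition subgraph :: "'v set \<Rightarrow> 'v edge set \<Rightarrow> 'v set \<Rightarrow> 'v edge set \<Rightarrow> bool" where
  "subgraph V' E' V E \<longleftrightarrow> bicoloured_multigraph V' E' \<and> V' \<subseteq> V \<and> E' \<subseteq> E"

definition sparse2 :: "nat \<Rightarrow> 'v set \<Rightarrow> 'v edge set \<Rightarrow> bool" where
  "sparse2 k V E \<longleftrightarrow>
     (\<forall>V' E'. subgraph V' E' V E \<and> card E' > 0 \<longrightarrow> int (card E') \<le> 2 * int (card V') - int k)"

definition tight2 :: "nat \<Rightarrow> 'v set \<Rightarrow> 'v edge set \<Rightarrow> bool" where
  "tight2 k V E \<longleftrightarrow> sparse2 k V E \<and> int (card E) = 2 * int (card V) - int k"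

definition limited_2_3 :: "'v set \<Rightarrow> 'v edge set \<Rightarrow> bool" where
  "limited_2_3 V E \<longleftrightarrow>
     (\<forall>V' E'. subgraph V' E' V E \<and> (\<forall>e\<in>E'. fst e = Blue) \<longrightarrow> sparse2 3 V' E')"

definition qnorm :: "real \<Rightarrow> real^2 \<Rightarrow> real" where
  "qnorm q x = (\<Sum>i\<in>UNIV. \<bar>x $ i\<bar> powr q) powr (1 / q)"

fun colour_dist :: "real \<Rightarrow> colour \<Rightarrow> real^2 \<Rightarrow> real^2 \<Rightarrow> real" where
  "colour_dist q Blue x y = norm (x - y)"
| "colour_dist q Red x y = qnorm q (x - y)"

definition edge_separation :: "real \<Rightarrow> ('v \<Rightarrow> real^2) \<Rightarrow> 'v edge \<Rightarrow> real" where
  "edge_separation q p e =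
     (THE d. \<exists>v w. snd e = {v, w} \<and> d = colour_dist q (fst e) (p v) (p w))"

lemma colour_dist_commute: "colour_dist q c x y = colour_dist q c y x"
  by (cases c) (simp_all add: norm_minus_commute qnorm_def abs_minus_commute)

text \<open>The separation does not depend on the order of the endpoints.\<close>

lemma edge_separation_pair:
  "edge_separation q p (c, {v, w}) = colour_dist q c (p v) (p w)"
  unfolding edge_separation_def
  by (rule the_equality) (auto simp: doubleton_eq_iff colour_dist_commute)

definition framework :: "'v set \<Rightarrow> 'v edge set \<Rightarrow> ('v \<Rightarrow> real^2) \<Rightarrow> bool" where
  "framework V E p \<longleftrightarrow> bicoloured_multigraph V E \<and> inj_on p V"

text \<open>
  The library's \<^const>\<open>jacobian\<close> and \<^const>\<open>rank\<close> need types as index sets. Rows are therefore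
  indexed by all conceivable edges and columns by all pairs of a vertex of the ambient type and a
  coordinate. Rows of non-edges and columns of vertices outside the graph vanish, so
  the rank is that of the matrix with rows indexed by \<open>E\<close> and columns by \<open>V \<times> {1, 2}\<close>.
  The separation map is differentiable at placements with distinct joints when \<open>q > 1\<close>; the matrix
  is only used there.
\<close>

definition separation_map ::
  "real \<Rightarrow> 'v::finite edge set \<Rightarrow> real^('v \<times> 2) \<Rightarrow> real^(colour \<times> 'v set)" where
  "separation_map q E x =
     (\<chi> e. if e \<in> E then edge_separation q (\<lambda>v. \<chi> i. x $ (v, i)) e else 0)"

definition rigidity_matrix ::
  "real \<Rightarrow> 'v::finite edge set \<Rightarrow> ('v \<Rightarrow> real^2) \<Rightarrow> real^('v \<times> 2)^(colour \<times> 'v set)" where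
  "rigidity_matrix q E p = jacobian (separation_map q E) (at (\<chi> j. p (fst j) $ snd j))"

definition infinitesimally_rigid ::
  "real \<Rightarrow> 'v::finite set \<Rightarrow> 'v edge set \<Rightarrow> ('v \<Rightarrow> real^2) \<Rightarrow> bool" where
  "infinitesimally_rigid q V E p \<longleftrightarrow>
     int (rank (rigidity_matrix q E p)) = 2 * int (card V) - 2"

definition minimally_infinitesimally_rigid ::
  "real \<Rightarrow> 'v::finite set \<Rightarrow> 'v edge set \<Rightarrow> ('v \<Rightarrow> real^2) \<Rightarrow> bool" where
  "minimally_infinitesimally_rigid q V E p \<longleftrightarrow>
     infinitesimally_rigid q V E p \<and> (\<forall>e\<in>E. \<not> infinitesimally_rigid q V (E - {e}) p)"

text \<open>
  Placements compared in the maximality condition have distinct joints. Complete regularity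
  depends on the graph only through its vertex set.
\<close>

definition completely_regular :: "real \<Rightarrow> 'v::finite set \<Rightarrow> ('v \<Rightarrow> real^2) \<Rightarrow> bool" where
  "completely_regular q V p \<longleftrightarrow>
     (\<forall>V' E'. subgraph V' E' V (complete_edges V) \<longrightarrow>
        (\<forall>p'. framework V' E' p' \<longrightarrow>
           rank (rigidity_matrix q E' p') \<le> rank (rigidity_matrix q E' p)))"

end

theory Submission
  imports Defs
begin

text \<open>
  Up to positive factors, the row of an edge \<open>vw\<close> of colour \<open>c\<close> sends a velocity field \<open>u\<close> to
  \<open>\<phi> \<bullet> (u v - u w)\<close>, where \<open>\<phi>\<close> is \<open>x = p v - p w\<close> for blue edges and the signed powers
  \<open>sgn x\<^sub>i \<bar>x\<^sub>i\<bar> powr (q - 1)\<close> for red ones. Translations, and for blue graphs the rotation, are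
  flexes, so independence of the rows gives the counts.

  Conversely, sparse graphs have independent rows, by induction on the vertices. Remove a vertex
  \<open>v\<close> of degree at most three; the remaining edge set \<open>F\<close> is independent. Two rows at \<open>v\<close> are never
  parallel, which settles degree at most two. If \<open>v\<close> has degree three and the rows are dependent at \<open>p\<close>, then by
  regularity they are dependent wherever \<open>v\<close> is put. Letting \<open>v\<close> tend to a neighbour \<open>a\<close> shows that
  every flex of \<open>F\<close> respects an edge from \<open>a\<close> to each other neighbour \<open>b\<close>, in the colour of \<open>vb\<close>.
  By the induction hypothesis such an edge cannot be added to \<open>F\<close> without violating the counts, so
  its endpoints lie in a set where a count is attained. These sets merge, by submodularity, into one containing
  all neighbours of \<open>v\<close>, which leaves no room for three edges at \<open>v\<close>. The only exception is a red
  \<open>K\<^sub>4\<close> on \<open>v\<close> and its neighbours; it is rigid, as the placement \<open>(0,0), (1,0), (0,1), (1,2)\<close> shows.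
\<close>

section \<open>The rows of the rigidity matrix\<close>

text \<open>For \<open>x \<noteq> 0\<close> this is a positive multiple of the gradient of the
  distance. Without the normalising factor it extends continuously by 0 to
  \<open>x = 0\<close>.\<close>

definition edge_dir :: "real \<Rightarrow> colour \<Rightarrow> real^2 \<Rightarrow> real^2" where
  "edge_dir q c x = (case c of Blue \<Rightarrow> x | Red \<Rightarrow> (\<chi> i. sgn (x $ i) * \<bar>x $ i\<bar> powr (q - 1)))"

lemma edge_dir_simps [simp]:
  "edge_dir q Blue x = x"
  "edge_dir q Red x $ i = sgn (x $ i) * \<bar>x $ i\<bar> powr (q - 1)"
  by (simp_all add: edge_dir_def)

lemma edge_dir_minus: "edge_dir q c (- x) = - edge_dir q c x"
  by (cases c) (simp_all add: vec_eq_iff sgn_minus)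

lemma edge_dir_zero [simp]: "edge_dir q c 0 = 0"
  by (cases c) (simp_all add: vec_eq_iff)

lemma edge_dir_eq_0_iff: "edge_dir q c x = 0 \<longleftrightarrow> x = 0"
  by (cases c) (auto simp add: vec_eq_iff sgn_eq_0_iff)

text \<open>Homogeneity of degree 1 for blue and \<open>q - 1\<close> for red. Hence a joint moving
  along a ray towards a neighbour keeps the normal of that edge up to a positive factor.\<close>

lemma edge_dir_scale:
  assumes "t > 0"
  obtains k where "k > 0" "edge_dir q c (t *\<^sub>R x) = k *\<^sub>R edge_dir q c x"
proof
  let ?k = "case c of Blue \<Rightarrow> t | Red \<Rightarrow> t powr (q - 1)"
  show "?k > 0" using assms by (cases c) auto
  show "edge_dir q c (t *\<^sub>R x) = ?k *\<^sub>R edge_dir q c x"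
    using assms by (cases c) (auto simp: vec_eq_iff sgn_mult abs_mult powr_mult)
qed

text \<open>The signed power with exponent \<open>1 / (q - 1)\<close> inverts the red map. A
  direction of approach can thus be chosen with any prescribed edge normal.\<close>

lemma edge_dir_surj:
  assumes "q > 1"
  obtains x where "edge_dir q c x = n"
proof (cases c)
  case Blue
  then show ?thesis using that by simp
next
  case Red
  have "edge_dir q c (\<chi> i. sgn (n $ i) * \<bar>n $ i\<bar> powr (1 / (q - 1))) = n"
    using assms Red
    by (auto simp: vec_eq_iff sgn_mult abs_mult powr_powr abs_sgn_eq mult_sgn_abs)
  then show ?thesis using that by blast
qed

lemma isCont_edge_dir:
  assumes "q > 1"
  shows "isCont (edge_dir q c) x"
proof (cases c)
  case Blue
  have "edge_dir q c = (\<lambda>x. x)" using Blue by auto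
  then show ?thesis by simp
next
  case Red
  have *: "isCont (\<lambda>t::real. sgn t * \<bar>t\<bar> powr (q - 1)) t" for t
  proof (cases "t = 0")
    case True
    \<comment> \<open>The sign jumps at 0, but the factor with positive exponent
      \<open>q - 1\<close> tends to 0 there and absorbs the jump.\<close>
    have "((\<lambda>t::real. \<bar>t\<bar> powr (q - 1)) \<longlongrightarrow> \<bar>0\<bar> powr (q - 1)) (at 0)"
      using assms by (intro tendsto_powr2 tendsto_intros) auto
    then have "((\<lambda>t::real. \<bar>t\<bar> powr (q - 1)) \<longlongrightarrow> 0) (at 0)"
      using assms by simp
    then have "((\<lambda>t::real. sgn t * \<bar>t\<bar> powr (q - 1)) \<longlongrightarrow> 0) (at 0)"
      by (rule Lim_null_comparison[rotated]) (auto simp: abs_mult abs_sgn_eq)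
    then show ?thesis using True by (simp add: isCont_def)
  next
    case False
    then show ?thesis
      unfolding isCont_def by (intro tendsto_intros) auto
  qed
  have "edge_dir q c = (\<lambda>x. \<chi> i. sgn (x $ i) * \<bar>x $ i\<bar> powr (q - 1))"
    using Red by (auto simp: vec_eq_iff)
  moreover have "((\<lambda>y. sgn (y $ i) * \<bar>y $ i\<bar> powr (q - 1)) \<longlongrightarrow> sgn (x $ i) * \<bar>x $ i\<bar> powr (q - 1)) (at x)" for i
    by (rule isCont_tendsto_compose[OF *]) (intro tendsto_intros)
  ultimately show ?thesis
    by (auto simp: isCont_def intro!: vec_tendstoI)
qed

lemma has_derivative_abs_powr:
  fixes t :: real
  assumes "q > 1"
  shows "((\<lambda>t. \<bar>t\<bar> powr q) has_real_derivative q * (sgn t * \<bar>t\<bar> powr (q - 1))) (at t)"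
proof (cases "t = 0")
  case True
  have "((\<lambda>t::real. \<bar>t\<bar> powr (q - 1)) \<longlongrightarrow> \<bar>0\<bar> powr (q - 1)) (at 0)"
    using assms by (intro tendsto_powr2 tendsto_intros) auto
  then have "((\<lambda>t::real. \<bar>t\<bar> powr (q - 1)) \<longlongrightarrow> 0) (at 0)"
    using assms by simp
  \<comment> \<open>The difference quotient at 0; its absolute value is the \<open>q - 1\<close>
    power of the absolute value of \<open>h\<close>.\<close>
  then have "((\<lambda>h. \<bar>h\<bar> powr q / h) \<longlongrightarrow> 0) (at (0::real))"
    by (rule Lim_null_comparison[rotated]) (auto simp: eventually_at_filter powr_diff)
  then show ?thesis using True by (simp add: DERIV_def)
next
  case False
  have "((\<lambda>t. \<bar>t\<bar>) has_real_derivative sgn t) (at t)"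
    using has_derivative_norm[OF False]
    by (simp add: has_field_derivative_def real_norm_def[abs_def] mult_commute_abs)
  moreover have "((\<lambda>t. t powr q) has_real_derivative q * \<bar>t\<bar> powr (q - 1)) (at \<bar>t\<bar>)"
    using False by (intro has_real_derivative_powr) auto
  ultimately show ?thesis
    using DERIV_chain2[of "\<lambda>t. t powr q" "q * \<bar>t\<bar> powr (q - 1)" abs t "sgn t" UNIV]
    by (simp add: mult_ac)
qed

text \<open>The normalising factor is hidden in \<open>k\<close>: only its positivity matters, since
  scaling rows does not change the rank.\<close>

lemma has_derivative_colour_norm:
  assumes "q > 1" "x \<noteq> 0"
  obtains k where "k > 0"
    "((\<lambda>x. colour_dist q c x 0) has_derivative (\<lambda>h. k * (edge_dir q c x \<bullet> h))) (at x)"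
proof (cases c)
  case Blue
  have "((\<lambda>x. colour_dist q c x 0) has_derivative (\<lambda>h. inverse (norm x) * (edge_dir q c x \<bullet> h))) (at x)"
    using has_derivative_norm[OF assms(2)] Blue by (simp add: sgn_div_norm inner_commute)
  then show ?thesis using assms(2) that[of "inverse (norm x)"] by simp
next
  case Red
  define S where "S = (\<lambda>x::real^2. \<Sum>i\<in>UNIV. \<bar>x $ i\<bar> powr q)"
  obtain i where i: "x $ i \<noteq> 0" using assms(2) by (auto simp: vec_eq_iff)
  have "S x \<ge> \<bar>x $ i\<bar> powr q" unfolding S_def by (rule member_le_sum) auto
  then have pos: "S x > 0" using i by (metis abs_eq_0 less_le_trans powr_gt_zero)
  have Sd: "(S has_derivative (\<lambda>h. q * (edge_dir q c x \<bullet> h))) (at x)"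
  proof -
    have "((\<lambda>x. \<bar>x $ i\<bar> powr q) has_derivative (\<lambda>h. q * (sgn (x $ i) * \<bar>x $ i\<bar> powr (q - 1)) * (h $ i))) (at x)" for i
    proof -
      have "((\<lambda>x. x $ i) has_derivative (\<lambda>h. h $ i)) (at x)"
        by (simp add: bounded_linear_imp_has_derivative bounded_linear_vec_nth)
      from has_derivative_compose[OF this
          has_derivative_abs_powr[OF assms(1), unfolded has_field_derivative_def]]
      show ?thesis .
    qed
    then have "(S has_derivative (\<lambda>h. \<Sum>i\<in>UNIV. q * (sgn (x $ i) * \<bar>x $ i\<bar> powr (q - 1)) * (h $ i))) (at x)"
      unfolding S_def by (intro has_derivative_sum)
    then show ?thesis using Red by (simp add: inner_vec_def sum_distrib_left mult.assoc)
  qed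
  have "((\<lambda>s. s powr (1/q)) has_real_derivative (1/q) * S x powr (1/q - 1)) (at (S x))"
    using pos by (rule has_real_derivative_powr)
  from has_derivative_compose[OF Sd has_field_derivative_imp_has_derivative[OF this]]
  have "((\<lambda>x. S x powr (1/q)) has_derivative (\<lambda>h. S x powr (1/q - 1) * (edge_dir q c x \<bullet> h))) (at x)"
    using assms(1) by simp
  then show ?thesis using pos Red that[of "S x powr (1/q - 1)"] by (simp add: qnorm_def S_def)
qed

section \<open>The rows as gradients of the edge separations\<close>

definition flatten :: "('v::finite \<Rightarrow> real^2) \<Rightarrow> real^('v \<times> 2)" where
  "flatten u = (\<chi> j. u (fst j) $ snd j)"

lemma flatten_nth [simp]: "flatten u $ (v, i) = u v $ i"
  by (simp add: flatten_def)

lemma surj_flatten: "\<exists>u. x = flatten u"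
  by (rule exI[of _ "\<lambda>v. \<chi> i. x $ (v, i)"]) (simp add: flatten_def vec_eq_iff)

lemma inner_flatten: "flatten x \<bullet> flatten y = (\<Sum>v\<in>UNIV. x v \<bullet> y v)"
  by (simp add: inner_vec_def flatten_def UNIV_Times_UNIV[symmetric] sum.cartesian_product'
      del: UNIV_Times_UNIV)

text \<open>Summing over both endpoints avoids choosing an order on the edge: the term with
  \<open>w = v\<close> is \<open>edge_dir\<close> at 0 and vanishes.\<close>

definition edge_row :: "real \<Rightarrow> ('v::finite \<Rightarrow> real^2) \<Rightarrow> 'v edge \<Rightarrow> real^('v \<times> 2)" where
  "edge_row q p e = flatten (\<lambda>v. if v \<in> snd e then \<Sum>w\<in>snd e. edge_dir q (fst e) (p v - p w) else 0)"

lemma edge_row_pair: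
  assumes "v \<noteq> w"
  shows "edge_row q p (c, {v, w}) =
    flatten (\<lambda>u. if u = v then edge_dir q c (p v - p w)
                 else if u = w then - edge_dir q c (p v - p w) else 0)"
  unfolding edge_row_def using assms
  by (auto simp: edge_dir_minus[symmetric] intro!: arg_cong[where f = flatten])

lemma inner_edge_row:
  assumes "v \<noteq> w"
  shows "edge_row q p (c, {v, w}) \<bullet> flatten u = edge_dir q c (p v - p w) \<bullet> (u v - u w)"
proof -
  let ?d = "edge_dir q c (p v - p w)"
  have "edge_row q p (c, {v, w}) \<bullet> flatten u =
    (\<Sum>x\<in>UNIV. (if x = v then ?d \<bullet> u v else 0) + (if x = w then - (?d \<bullet> u w) else 0))"
    unfolding edge_row_pair[OF assms] inner_flatten using assms
    by (intro sum.cong) auto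
  also have "\<dots> = ?d \<bullet> u v - ?d \<bullet> u w"
    by (simp add: sum.distrib)
  finally show ?thesis by (simp add: inner_diff_right)
qed

lemma complete_edges_iff: "e \<in> complete_edges V \<longleftrightarrow> snd e \<subseteq> V \<and> card (snd e) = 2"
  by (cases e) (simp add: complete_edges_def)

lemma complete_edgesE:
  assumes "e \<in> complete_edges V"
  obtains c v w where "e = (c, {v, w})" "v \<noteq> w" "v \<in> V" "w \<in> V"
  using assms that unfolding complete_edges_def card_2_iff by fastforce

lemma pair_in_complete_edges [simp]: "(c, {v, w}) \<in> complete_edges V \<longleftrightarrow> v \<in> V \<and> w \<in> V \<and> v \<noteq> w"
  by (auto simp: complete_edges_def card_insert_if)

text \<open>Each row of the Jacobian is a positive multiple of an \<open>edge_row\<close> or, off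
  \<open>E\<close>, zero, so the row spaces agree. Distinct joints keep the distances
  differentiable.\<close>

lemma rank_rigidity_matrix:
  fixes p :: "'v::finite \<Rightarrow> real^2"
  assumes "q > 1" "E \<subseteq> complete_edges V" "inj_on p V"
  shows "rank (rigidity_matrix q E p) = dim (edge_row q p ` E)"
proof -
  let ?x = "flatten p"
  have "\<exists>k>0. ((\<lambda>x. edge_separation q (\<lambda>v. \<chi> i. x $ (v, i)) e) has_derivative
      (\<lambda>h. k * (edge_row q p e \<bullet> h))) (at ?x)" if e: "e \<in> E" for e
  proof -
    obtain c v w where e: "e = (c, {v, w})" "v \<noteq> w" "v \<in> V" "w \<in> V"
      using assms(2) e complete_edgesE by (metis subsetD)
    then have "p v - p w \<noteq> 0" using assms(3) by (auto dest: inj_onD)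
    then obtain k where k: "k > 0"
      "((\<lambda>x. colour_dist q c x 0) has_derivative (\<lambda>h. k * (edge_dir q c (p v - p w) \<bullet> h))) (at (p v - p w))"
      using has_derivative_colour_norm assms(1) by metis
    define L where "L = (\<lambda>x::real^('v \<times> 2). (\<chi> i. x $ (v, i)) - (\<chi> i. x $ (w, i)) :: real^2)"
    have "linear L" unfolding L_def by (rule linearI) (auto simp: vec_eq_iff algebra_simps)
    then have L: "(L has_derivative L) (at ?x)"
      by (simp add: linear_imp_has_derivative)
    have Lf: "L (flatten u) = u v - u w" for u
      by (simp add: L_def vec_eq_iff)
    have "((\<lambda>x. colour_dist q c (L x) 0) has_derivative (\<lambda>h. k * (edge_dir q c (p v - p w) \<bullet> L h))) (at ?x)"
      using has_derivative_compose[OF L, of "\<lambda>x. colour_dist q c x 0"] k by (simp add: Lf)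
    moreover have "colour_dist q c (L x) 0 = edge_separation q (\<lambda>v. \<chi> i. x $ (v, i)) e" for x
      unfolding e edge_separation_pair L_def by (cases c) auto
    moreover have "edge_dir q c (p v - p w) \<bullet> L h = edge_row q p e \<bullet> h" for h
      using surj_flatten[of h] e by (auto simp: Lf inner_edge_row)
    ultimately show ?thesis using k by auto
  qed
  then obtain k where k: "\<And>e. e \<in> E \<Longrightarrow> k e > 0"
    "\<And>e. e \<in> E \<Longrightarrow> ((\<lambda>x. edge_separation q (\<lambda>v. \<chi> i. x $ (v, i)) e) has_derivative
      (\<lambda>h. k e * (edge_row q p e \<bullet> h))) (at ?x)"
    by metis
  define D where "D = (\<lambda>h. \<chi> e. if e \<in> E then k e * (edge_row q p e \<bullet> h) else 0)"
  have "(separation_map q E has_derivative D) (at ?x)"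
    unfolding has_derivative_componentwise_within[of "separation_map q E"]
  proof
    fix b :: "real^(colour \<times> 'v set)" assume "b \<in> Basis"
    then obtain e where b: "b = axis e 1" by (auto simp: Basis_vec_def)
    show "((\<lambda>x. separation_map q E x \<bullet> b) has_derivative (\<lambda>x. D x \<bullet> b)) (at ?x)"
      unfolding b inner_axis separation_map_def D_def using k(2)[of e]
        by (cases "e \<in> E") simp_all
  qed
  then have "frechet_derivative (separation_map q E) (at ?x) = D"
    by (rule frechet_derivative_at[symmetric])
  then have "rigidity_matrix q E p = matrix D"
    by (simp add: rigidity_matrix_def jacobian_def flatten_def)
  then have row: "row e (rigidity_matrix q E p) = (if e \<in> E then k e *\<^sub>R edge_row q p e else 0)" for e
    by (cases e) (simp add: row_def matrix_def D_def vec_eq_iff inner_axis)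
  have "span (rows (rigidity_matrix q E p)) = span (edge_row q p ` E)"
  proof (rule span_eq[THEN iffD2], intro conjI subsetI)
    fix x assume "x \<in> rows (rigidity_matrix q E p)"
    then show "x \<in> span (edge_row q p ` E)"
      by (auto simp: rows_def row span_base span_mul span_zero split: if_splits)
  next
    fix x assume "x \<in> edge_row q p ` E"
    then obtain e where e: "e \<in> E" "x = edge_row q p e" by blast
    then have "k e *\<^sub>R x \<in> span (rows (rigidity_matrix q E p))"
      using row[of e] by (intro span_base) (metis (mono_tags, lifting) rows_def mem_Collect_eq UNIV_I)
    from span_mul[OF this, of "inverse (k e)"] show "x \<in> span (rows (rigidity_matrix q E p))"
      using k(1)[OF e(1)] by simp
  qed
  then show ?thesis unfolding row_rank_def by (rule span_eq_dim)
qed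

section \<open>Ranks and flexes\<close>

text \<open>A span is its own double orthogonal complement: the component of \<open>x\<close>
  orthogonal to the span is tested against itself. This turns row dependence into a statement on
  flexes.\<close>

lemma in_span_iff_orthogonal:
  fixes x :: "'a::euclidean_space"
  shows "x \<in> span S \<longleftrightarrow> (\<forall>y. (\<forall>s\<in>S. s \<bullet> y = 0) \<longrightarrow> x \<bullet> y = 0)"
proof
  assume "x \<in> span S"
  then show "\<forall>y. (\<forall>s\<in>S. s \<bullet> y = 0) \<longrightarrow> x \<bullet> y = 0"
    using orthogonal_to_span[of x S] by (metis inner_commute orthogonal_def)
next
  assume *: "\<forall>y. (\<forall>s\<in>S. s \<bullet> y = 0) \<longrightarrow> x \<bullet> y = 0"
  obtain y z where yz: "y \<in> span S" "\<And>w. w \<in> span S \<Longrightarrow> orthogonal z w" "x = y + z"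
    using orthogonal_subspace_decomp_exists[of S x] by blast
  then have "\<forall>s\<in>S. s \<bullet> z = 0" by (metis inner_commute orthogonal_def span_base)
  then have "x \<bullet> z = 0" using * by blast
  moreover have "y \<bullet> z = 0" using yz by (metis inner_commute orthogonal_def)
  ultimately have "z \<bullet> z = 0" using yz(3) by (simp add: inner_add_left)
  then show "x \<in> span S" using yz by simp
qed

text \<open>Forgetting the coordinates outside \<open>K\<close> is linear and injective on the
  span.\<close>

lemma dim_le_card_coordinates:
  fixes S :: "(real^'n) set"
  assumes "\<And>x. x \<in> span S \<Longrightarrow> (\<And>j. j \<in> K \<Longrightarrow> x $ j = 0) \<Longrightarrow> x = 0"
  shows "dim S \<le> card K"
proof -
  define L where "L = (\<lambda>x::real^'n. \<chi> j. if j \<in> K then x $ j else 0)"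
  have lin: "linear L" unfolding L_def by (rule linearI) (auto simp: vec_eq_iff)
  have "inj_on L (span S)"
    unfolding linear_injective_on_subspace_0[OF lin subspace_span]
  proof (intro ballI impI)
    fix x assume "x \<in> span S" "L x = 0"
    then show "x = 0" using assms[of x] by (simp add: L_def vec_eq_iff) metis
  qed
  then have "dim S = dim (L ` S)"
    using dim_image_eq[OF lin] by simp
  also have "\<dots> \<le> card ((\<lambda>j. axis j (1::real)) ` K)"
  proof (rule dim_le_card)
    show "L ` S \<subseteq> span ((\<lambda>j. axis j 1) ` K)"
    proof clarify
      fix x
      have "L x = (\<Sum>j\<in>K. x $ j *\<^sub>R axis j 1)"
        by (simp add: L_def vec_eq_iff axis_def if_distrib cong: if_cong)
      then show "L x \<in> span ((\<lambda>j. axis j 1) ` K)"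
        by (simp only:) (intro span_sum span_mul span_base imageI)
    qed
  qed auto
  also have "\<dots> \<le> card K" by (rule card_image_le) auto
  finally show ?thesis .
qed

abbreviation edge_rank :: "real \<Rightarrow> ('v::finite \<Rightarrow> real^2) \<Rightarrow> 'v edge set \<Rightarrow> nat" where
  "edge_rank q p E \<equiv> dim (edge_row q p ` E)"

text \<open>Infinitesimal flexes, stated with unnormalised rows. Velocities of vertices on no edge
  of \<open>E\<close> are unconstrained.\<close>

definition flex :: "real \<Rightarrow> ('v::finite \<Rightarrow> real^2) \<Rightarrow> 'v edge set \<Rightarrow> ('v \<Rightarrow> real^2) \<Rightarrow> bool" where
  "flex q p E u \<longleftrightarrow> (\<forall>e\<in>E. edge_row q p e \<bullet> flatten u = 0)"

lemma flex_empty [simp]: "flex q p {} u"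
  by (simp add: flex_def)

lemma flex_insert: "flex q p (insert e E) u \<longleftrightarrow> edge_row q p e \<bullet> flatten u = 0 \<and> flex q p E u"
  by (simp add: flex_def)

lemma flex_subset: "flex q p E u \<Longrightarrow> F \<subseteq> E \<Longrightarrow> flex q p F u"
  by (auto simp: flex_def)

lemma edge_row_in_span_iff:
  "edge_row q p e \<in> span (edge_row q p ` F) \<longleftrightarrow>
    (\<forall>u. flex q p F u \<longrightarrow> edge_row q p e \<bullet> flatten u = 0)"
  proof -
  have "(\<forall>y. P y) \<longleftrightarrow> (\<forall>u. P (flatten u))" for P :: "real^('a \<times> 2) \<Rightarrow> bool"
    using surj_flatten by metis
  then show ?thesis unfolding in_span_iff_orthogonal flex_def by simp
qed

lemma edge_rank_insert:
  "edge_rank q p (insert e F) =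
    (if \<forall>u. flex q p F u \<longrightarrow> edge_row q p e \<bullet> flatten u = 0 then edge_rank q p F else edge_rank q p F + 1)"
  by (simp add: dim_insert edge_row_in_span_iff)

lemma edge_rank_le_card: "edge_rank q p E \<le> card E"
  using dim_le_card'[of "edge_row q p ` E"] card_image_le[of E "edge_row q p"] by simp

lemma edge_rank_Un: "edge_rank q p (E \<union> F) \<le> edge_rank q p E + card F"
proof -
  have "finite F" by simp
  then show ?thesis by (induction F) (auto simp: dim_insert)
qed

lemma edge_rank_card_subset:
  assumes "edge_rank q p E = card E" "F \<subseteq> E"
  shows "edge_rank q p F = card F"
proof -
  have "card E \<le> edge_rank q p F + card (E - F)"
    using edge_rank_Un[of q p F "E - F"] assms by (simp add: Un_absorb1)
  moreover have "card (E - F) = card E - card F" "card F \<le> card E"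
    using assms(2) by (simp_all add: card_Diff_subset card_mono)
  ultimately show ?thesis using edge_rank_le_card[of q p F] by linarith
qed

text \<open>A row in the span of the others could be deleted without loss of rank. This is how
  minimality yields independence.\<close>

lemma edge_rank_eq_cardI:
  assumes "\<And>e. e \<in> E \<Longrightarrow> edge_rank q p (E - {e}) \<noteq> edge_rank q p E"
  shows "edge_rank q p E = card E"
proof -
  have *: "edge_row q p e \<notin> span (edge_row q p ` (E - {e}))" if "e \<in> E" for e
    using dim_insert[of "edge_row q p e" "edge_row q p ` (E - {e})"] assms[OF that] that
    by (metis image_insert insert_Diff)
  have "finite E" by simp
  then show ?thesis
    using *
  proof (induction E)
    case (insert e E)
    have "edge_row q p f \<notin> span (edge_row q p ` (E - {f}))" if "f \<in> E" for f
      using insert.prems[of f] that span_mono[of "edge_row q p ` (E - {f})" "edge_row q p ` (insert e E - {f})"]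
      by auto
    then have "edge_rank q p E = card E" by (rule insert.IH)
    moreover have "edge_row q p e \<notin> span (edge_row q p ` E)"
      using insert.prems[of e] insert.hyps by simp
    ultimately show ?case using insert.hyps by (simp add: dim_insert)
  qed simp
qed

section \<open>Upper bounds on the rank\<close>

lemma flex_translation:
  assumes "E \<subseteq> complete_edges W" "\<And>v. v \<in> W \<Longrightarrow> u v = a"
  shows "flex q p E u"
  unfolding flex_def
proof
  fix e assume "e \<in> E"
  then obtain c v w where "e = (c, {v, w})" "v \<noteq> w" "v \<in> W" "w \<in> W"
    using assms(1) complete_edgesE by (metis subsetD)
  then show "edge_row q p e \<bullet> flatten u = 0" using assms(2) by (simp add: inner_edge_row)
qed

text \<open>Elements of the row space are orthogonal to all flexes. The test flexes are, in turn,
  motions of a single vertex outside \<open>W\<close>, translations and \<open>u\<close>.\<close>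

lemma span_edge_rows:
  assumes "flatten x \<in> span (edge_row q p ` E)" "E \<subseteq> complete_edges W"
  shows "v \<notin> W \<Longrightarrow> x v = 0" "(\<Sum>v\<in>W. x v) = 0" "flex q p E u \<Longrightarrow> (\<Sum>v\<in>W. x v \<bullet> u v) = 0"
proof -
  have orth: "flatten x \<bullet> flatten u = 0" if "flex q p E u" for u
    using assms(1) that unfolding in_span_iff_orthogonal flex_def by blast
  show out: "x v = 0" if "v \<notin> W" for v
  proof -
    have "flex q p E (\<lambda>w. if w = v then x v else 0)"
      by (rule flex_translation[OF assms(2), of _ 0]) (use that in auto)
    from orth[OF this] show ?thesis by (simp add: inner_flatten if_distrib cong: if_cong)
  qed
  have sum: "(\<Sum>v\<in>W. x v \<bullet> u v) = 0" if "flex q p E u" for u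
  proof -
    have "(\<Sum>v\<in>W. x v \<bullet> u v) = (\<Sum>v\<in>UNIV. x v \<bullet> u v)"
      using out by (intro sum.mono_neutral_left) auto
    then show ?thesis using orth[OF that] by (simp add: inner_flatten)
  qed
  then show "flex q p E u \<Longrightarrow> (\<Sum>v\<in>W. x v \<bullet> u v) = 0" .
  \<comment> \<open>The translation by the sum itself is used as test flex, so the squared length of
    the sum vanishes.\<close>
  have "(\<Sum>v\<in>W. x v) \<bullet> (\<Sum>v\<in>W. x v) = (\<Sum>v\<in>W. x v \<bullet> (\<Sum>v\<in>W. x v))"
    by (simp add: inner_sum_left)
  also have "\<dots> = 0" by (rule sum, rule flex_translation[OF assms(2)]) auto
  finally show "(\<Sum>v\<in>W. x v) = 0" by simp
qed

text \<open>The entries of a row-space element sum to zero, so those at \<open>w\<close> follow from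
  the others.\<close>

lemma edge_rank_le:
  assumes "E \<subseteq> complete_edges W" "W \<noteq> {}"
  shows "int (edge_rank q p E) \<le> 2 * int (card W) - 2"
proof -
  obtain w where w: "w \<in> W" using assms(2) by blast
  have "edge_rank q p E \<le> card ((W - {w}) \<times> (UNIV :: 2 set))"
  proof (rule dim_le_card_coordinates)
    fix x assume x: "x \<in> span (edge_row q p ` E)" and 0: "\<And>j. j \<in> (W - {w}) \<times> UNIV \<Longrightarrow> x $ j = 0"
    obtain y where y: "x = flatten y" using surj_flatten by blast
    note y' = span_edge_rows[OF x[unfolded y] assms(1)]
    have z: "y v = 0" if "v \<noteq> w" for v
      using y'(1)[of v] 0[of "(v, _)"] that by (cases "v \<in> W") (auto simp: y vec_eq_iff)
    then have "(\<Sum>v\<in>W. y v) = y w" using w by (subst sum.remove[of W w]) auto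
    then have "y v = 0" for v using z y'(2) by (cases "v = w") auto
    then show "x = 0" by (simp add: y vec_eq_iff)
  qed
  moreover have "card W > 0" using w by (auto simp: card_gt_0_iff)
  ultimately show ?thesis using w by (simp add: card_cartesian_product)
qed

text \<open>A flex that is no translation on \<open>W\<close> gives one more linear relation on the
  row space, which determines one further coordinate.\<close>

lemma edge_rank_le_of_flex:
  assumes "E \<subseteq> complete_edges W" "v \<in> W" "w \<in> W" "flex q p E u" "u v \<noteq> u w"
  shows "int (edge_rank q p E) \<le> 2 * int (card W) - 3"
proof -
  obtain i where i: "u v $ i \<noteq> u w $ i" using assms(5) by (auto simp: vec_eq_iff)
  have vw: "v \<noteq> w" using assms(5) by auto
  \<comment> \<open>Both coordinates at \<open>w\<close> are dropped because of translations, and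
    the one at \<open>v\<close> in which \<open>u v\<close> and \<open>u w\<close> differ because of
    \<open>u\<close>.\<close>
  let ?K = "(W - {w}) \<times> (UNIV :: 2 set) - {(v, i)}"
  have "edge_rank q p E \<le> card ?K"
  proof (rule dim_le_card_coordinates)
    fix x assume x: "x \<in> span (edge_row q p ` E)" and 0: "\<And>j. j \<in> ?K \<Longrightarrow> x $ j = 0"
    obtain y where y: "x = flatten y" using surj_flatten by blast
    note y' = span_edge_rows[OF x[unfolded y] assms(1)]
    have z: "y a = 0" if "a \<noteq> v" "a \<noteq> w" for a
      using y'(1)[of a] 0[of "(a, _)"] that by (cases "a \<in> W") (auto simp: y vec_eq_iff)
    have sum2: "(\<Sum>a\<in>W. f a) = f v + f w" if "\<And>a. a \<noteq> v \<Longrightarrow> a \<noteq> w \<Longrightarrow> f a = 0" for f :: "_ \<Rightarrow> 'b::comm_monoid_add"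
    proof -
      have "(\<Sum>a\<in>W. f a) = (\<Sum>a\<in>{v, w}. f a)"
        using assms that by (intro sum.mono_neutral_right) auto
      then show ?thesis using vw by simp
    qed
    have yw: "y w = - y v" using y'(2) sum2[of y] z by (simp add: add_eq_0_iff2)
    have "y v \<bullet> u v + y w \<bullet> u w = 0"
      using y'(3)[OF assms(4)] sum2[of "\<lambda>a. y a \<bullet> u a"] z by simp
    then have "y v \<bullet> (u v - u w) = 0" by (simp add: yw inner_diff_right)
    moreover have yj: "y v $ j = 0" if "j \<noteq> i" for j
      using 0[of "(v, j)"] that assms vw by (auto simp: y)
    ultimately have "y v $ i * (u v $ i - u w $ i) = 0"
      using exhaust_2[of i] by (auto simp: inner_vec_def UNIV_2)
    then have "y v $ i = 0" using i by simp
    then have "y v = 0" using yj by (auto simp: vec_eq_iff) metis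
    then have "y a = 0" for a using z[of a] yw by (cases "a = v"; cases "a = w") auto
    then show "x = 0" by (simp add: y vec_eq_iff)
  qed
  moreover have "card ?K = 2 * (card W - 1) - 1"
    using assms vw by (subst card_Diff_singleton) (auto simp: card_cartesian_product)
  moreover have "card W \<ge> 2"
    using card_mono[of W "{v, w}"] assms vw by simp
  ultimately show ?thesis by linarith
qed

text \<open>Blue edges admit the infinitesimal rotation.\<close>

lemma edge_rank_blue_le:
  assumes "E \<subseteq> complete_edges W" "v \<in> W" "w \<in> W" "p v \<noteq> p w" "\<And>e. e \<in> E \<Longrightarrow> fst e = Blue"
  shows "int (edge_rank q p E) \<le> 2 * int (card W) - 3"
proof -
  \<comment> \<open>Rotation by a right angle: linear, with \<open>J x\<close> orthogonal to
    \<open>x\<close>.\<close>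
  define J where "J = (\<lambda>x::real^2. (vector [- x $ 2, x $ 1] :: real^2))"
  have "flex q p E (\<lambda>v. J (p v))"
    unfolding flex_def
  proof
    fix e assume e: "e \<in> E"
    then obtain c a b where "e = (c, {a, b})" "a \<noteq> b"
      using assms(1) complete_edgesE by (metis subsetD)
    moreover have "c = Blue" using assms(5)[OF e] calculation by simp
    ultimately have "edge_row q p e \<bullet> flatten (\<lambda>v. J (p v)) = (p a - p b) \<bullet> (J (p a) - J (p b))"
      by (simp add: inner_edge_row)
    then show "edge_row q p e \<bullet> flatten (\<lambda>v. J (p v)) = 0"
      by (simp add: J_def inner_vec_def UNIV_2 algebra_simps)
  qed
  moreover have "J (p v) \<noteq> J (p w)"
    using assms(4) by (auto simp: J_def vec_eq_iff forall_2)
  ultimately show ?thesis using edge_rank_le_of_flex assms by blast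
qed

section \<open>Determinants and perpendiculars in the plane\<close>

definition cross2 :: "real^2 \<Rightarrow> real^2 \<Rightarrow> real" where
  "cross2 a b = a $ 1 * b $ 2 - a $ 2 * b $ 1"

lemma cross2_eq_0_if_orthogonal:
  assumes "a \<bullet> w = 0" "b \<bullet> w = 0" "w \<noteq> 0"
  shows "cross2 a b = 0"
proof -
  have "a $ 1 * w $ 1 + a $ 2 * w $ 2 = 0" "b $ 1 * w $ 1 + b $ 2 * w $ 2 = 0"
    using assms by (simp_all add: inner_vec_def UNIV_2)
  then have "cross2 a b * w $ 1 = 0" "cross2 a b * w $ 2 = 0"
    unfolding cross2_def by algebra+
  then show ?thesis using assms(3) by (auto simp: vec_eq_iff forall_2)
qed

definition perp :: "real^2 \<Rightarrow> real^2" where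
  "perp a = vector [- a $ 2, a $ 1]"

lemma inner_perp: "b \<bullet> perp a = cross2 a b"
  by (simp add: inner_vec_def UNIV_2 cross2_def perp_def algebra_simps)

lemma perp_eq_0_iff [simp]: "perp a = 0 \<longleftrightarrow> a = 0"
  by (auto simp: perp_def vec_eq_iff forall_2)

lemma cross2_self [simp]: "cross2 a a = 0"
  by (simp add: cross2_def)

lemma cross2_zero [simp]: "cross2 0 a = 0" "cross2 a 0 = 0"
  by (simp_all add: cross2_def)

text \<open>Parallel normals have a common perpendicular, later used as the velocity of a flex that
  moves one vertex only.\<close>

lemma cross2_eq_0_obtain:
  assumes "cross2 a b = 0"
  obtains w where "a \<bullet> w = 0" "b \<bullet> w = 0" "w \<noteq> 0"
proof (cases "a = 0")
  case True
  show ?thesis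
  proof (cases "b = 0")
    case True
    then show ?thesis using \<open>a = 0\<close> that[of "axis 1 1"] by simp
  next
    case False
    then show ?thesis using True that[of "perp b"] by (simp add: inner_perp)
  qed
next
  case False
  then show ?thesis using that[of "perp a"] assms by (simp add: inner_perp)
qed


section \<open>Attaching edges to a vertex\<close>

lemma edge_row_update:
  assumes "v \<notin> snd e"
  shows "edge_row q (p(v := x)) e = edge_row q p e"
  unfolding edge_row_def using assms
  by (intro arg_cong[where f = flatten] ext) (auto intro!: sum.cong)

lemma inner_edge_row_update:
  assumes "v \<notin> snd e"
  shows "edge_row q p e \<bullet> flatten (u(v := x)) = edge_row q p e \<bullet> flatten u"
  unfolding edge_row_def inner_flatten using assms by (intro sum.cong) auto

lemma edge_rank_update:
  assumes "\<And>e. e \<in> F \<Longrightarrow> v \<notin> snd e"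
  shows "edge_rank q (p(v := x)) F = edge_rank q p F"
  using assms edge_row_update by (metis (no_types, lifting) image_cong)

lemma flex_update:
  assumes "\<And>e. e \<in> F \<Longrightarrow> v \<notin> snd e"
  shows "flex q (p(v := x)) F (u(v := w)) \<longleftrightarrow> flex q p F u"
  using assms by (simp add: flex_def edge_row_update inner_edge_row_update)

lemma edge_rank_insert_indep:
  assumes "edge_rank q p F = card F" "flex q p F u" "edge_row q p e \<bullet> flatten u \<noteq> 0"
  shows "edge_rank q p (insert e F) = card (insert e F)"
proof -
  have "e \<notin> F" using assms by (auto simp: flex_def)
  moreover have "edge_rank q p (insert e F) = edge_rank q p F + 1"
    using assms(2,3) by (subst edge_rank_insert) auto
  ultimately show ?thesis using assms(1) by simp
qed

lemma flatten_0 [simp]: "flatten (\<lambda>_. 0) = 0"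
  by (simp add: vec_eq_iff)

lemma flex_single_vertex:
  assumes "\<And>e. e \<in> F \<Longrightarrow> v \<notin> snd e"
  shows "flex q p F ((\<lambda>_. 0)(v := w))"
  using assms by (simp add: flex_def inner_edge_row_update)

text \<open>Moving only \<open>v\<close>, along the edge normal, is a flex of \<open>F\<close> that
  violates the new edge.\<close>

lemma edge_rank_add_edge:
  assumes "edge_rank q p F = card F" "\<And>e. e \<in> F \<Longrightarrow> v \<notin> snd e" "v \<noteq> a" "p v \<noteq> p a"
  shows "edge_rank q p (insert (c, {v, a}) F) = card (insert (c, {v, a}) F)"
  by (rule edge_rank_insert_indep[OF assms(1) flex_single_vertex[of F v _ _ "edge_dir q c (p v - p a)"]])
     (use assms in \<open>auto simp: inner_edge_row edge_dir_eq_0_iff\<close>)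

text \<open>Moving only \<open>v\<close>, perpendicular to the first normal, respects
  \<open>F\<close> and the first edge but violates the second.\<close>

lemma edge_rank_add_two_edges:
  assumes F: "edge_rank q p F = card F" "\<And>e. e \<in> F \<Longrightarrow> v \<notin> snd e"
    and ab: "v \<noteq> a" "v \<noteq> b"
    and cross: "cross2 (edge_dir q c (p v - p a)) (edge_dir q d (p v - p b)) \<noteq> 0"
  shows "edge_rank q p (insert (d, {v, b}) (insert (c, {v, a}) F)) =
    card (insert (d, {v, b}) (insert (c, {v, a}) F))"
proof -
  let ?m = "edge_dir q c (p v - p a)"
  have "?m \<noteq> 0" using cross by auto
  then have 1: "edge_rank q p (insert (c, {v, a}) F) = card (insert (c, {v, a}) F)"
    using F ab by (intro edge_rank_add_edge) (auto simp: edge_dir_eq_0_iff)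
  have "flex q p (insert (c, {v, a}) F) ((\<lambda>_. 0)(v := perp ?m))"
    using flex_single_vertex[of F v] F(2) ab by (auto simp: flex_insert inner_edge_row inner_perp)
  then show ?thesis
    by (rule edge_rank_insert_indep[OF 1]) (use ab cross in \<open>auto simp: inner_edge_row inner_perp\<close>)
qed

text \<open>Cramer's rule.\<close>

lemma solve2:
  assumes "cross2 m n \<noteq> 0"
  obtains w where "m \<bullet> w = s" "n \<bullet> w = t"
proof
  let ?w = "(1 / cross2 m n) *\<^sub>R (t *\<^sub>R perp m - s *\<^sub>R perp n)"
  have "cross2 n m = - cross2 m n" by (simp add: cross2_def)
  then show "m \<bullet> ?w = s" "n \<bullet> ?w = t"
    using assms by (simp_all add: inner_diff_right inner_perp)
qed

text \<open>Two edges with non-parallel normals determine the velocity of \<open>v\<close>. If the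
  third edge were violated, its row would be independent of the others, against the dependence of
  \<open>E\<close>.\<close>

lemma flex_extends:
  assumes F: "edge_rank q p F = card F" "\<And>e. e \<in> F \<Longrightarrow> v \<notin> snd e" "flex q p F u"
    and ab: "v \<noteq> a1" "v \<noteq> a2" "v \<noteq> a3"
    and cross: "cross2 (edge_dir q c1 (p v - p a1)) (edge_dir q c2 (p v - p a2)) \<noteq> 0"
    and E: "E = insert (c3, {v, a3}) (insert (c2, {v, a2}) (insert (c1, {v, a1}) F))"
      "edge_rank q p E \<noteq> card E"
  obtains w where "flex q p E (u(v := w))"
    "edge_dir q c1 (p v - p a1) \<bullet> (w - u a1) = 0"
    "edge_dir q c2 (p v - p a2) \<bullet> (w - u a2) = 0"
    "edge_dir q c3 (p v - p a3) \<bullet> (w - u a3) = 0"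
proof -
  obtain w where w: "edge_dir q c1 (p v - p a1) \<bullet> w = edge_dir q c1 (p v - p a1) \<bullet> u a1"
    "edge_dir q c2 (p v - p a2) \<bullet> w = edge_dir q c2 (p v - p a2) \<bullet> u a2"
    using solve2[OF cross] by metis
  let ?E' = "insert (c2, {v, a2}) (insert (c1, {v, a1}) F)"
  have 1: "edge_rank q p ?E' = card ?E'"
    using edge_rank_add_two_edges[OF F(1,2) ab(1,2) cross] .
  have "flex q p F (u(v := w))"
    using F(2,3) by (simp add: flex_def inner_edge_row_update)
  then have 2: "flex q p ?E' (u(v := w))"
    using ab w by (simp add: flex_insert inner_edge_row inner_diff_right)
  have 3: "edge_row q p (c3, {v, a3}) \<bullet> flatten (u(v := w)) = 0"
    using edge_rank_insert_indep[OF 1 2, of "(c3, {v, a3})"] E by auto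
  show ?thesis
    using that[of w] 2 3 w ab by (simp add: E(1) flex_insert inner_edge_row inner_diff_right)
qed

text \<open>Linear dependence of the three augmented rows \<open>(n, 0)\<close>, \<open>(a, a \<bullet> s)\<close>, \<open>(b, b \<bullet> t)\<close>.\<close>

lemma cross2_consistency:
  assumes "n \<bullet> y = 0" "a \<bullet> (y - s) = 0" "b \<bullet> (y - t) = 0"
  shows "cross2 n a * (b \<bullet> t) = cross2 n b * (a \<bullet> s)"
proof -
  have "n $ 1 * y $ 1 + n $ 2 * y $ 2 = 0" "a \<bullet> s = a $ 1 * y $ 1 + a $ 2 * y $ 2"
    "b \<bullet> t = b $ 1 * y $ 1 + b $ 2 * y $ 2"
    using assms by (simp_all add: inner_diff_right, simp_all add: inner_vec_def UNIV_2)
  then show ?thesis unfolding cross2_def by algebra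
qed

section \<open>Regular placements\<close>

text \<open>The place where \<open>q \<noteq> 2\<close> enters: test placements with a joint
  difference having coordinates of absolute value 1 and 2 tell the two norms apart.\<close>

lemma two_powr_neq_2: "q \<noteq> 2 \<Longrightarrow> 2 powr (q - 1) \<noteq> (2::real)"
  using powr_inj[of 2 "q - 1" 1] by simp

lemma tendsto_cross2 [tendsto_intros]:
  "(f \<longlongrightarrow> a) G \<Longrightarrow> (g \<longlongrightarrow> b) G \<Longrightarrow> ((\<lambda>t. cross2 (f t) (g t)) \<longlongrightarrow> cross2 a b) G"
  unfolding cross2_def by (intro tendsto_intros)

lemma cross2_commute: "cross2 a b = - cross2 b a"
  by (simp add: cross2_def)

lemma cross2_scale [simp]: "cross2 (k *\<^sub>R a) b = k * cross2 a b"
  by (simp add: cross2_def algebra_simps)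

lemma vector2_eq_iff: "(vector [a, b] :: real^2) = vector [c, d] \<longleftrightarrow> a = c \<and> b = d"
  by (simp add: vec_eq_iff forall_2)

lemma edge_dir_vector:
  "edge_dir q Red (vector [a, b]) = vector [sgn a * \<bar>a\<bar> powr (q - 1), sgn b * \<bar>b\<bar> powr (q - 1)]"
  by (simp add: vec_eq_iff forall_2)

lemma vector2_diff: "(vector [a, b] :: real^2) - vector [c, d] = vector [a - c, b - d]"
  by (simp add: vec_eq_iff forall_2)

lemma cross2_vector: "cross2 (vector [a, b]) (vector [c, d]) = a * d - b * c"
  by (simp add: cross2_def)

lemma inner_vector: "(vector [a, b] :: real^2) \<bullet> vector [c, d] = a * c + b * d"
  by (simp add: inner_vec_def UNIV_2)

lemma edge_dir_axis: "edge_dir q c (vector [1, 0]) = vector [1, 0]"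
  by (cases c; simp add: edge_dir_vector)

locale regular_placement =
  fixes q :: real and V :: "'v::finite set" and p :: "'v \<Rightarrow> real^2"
  assumes q_gt_1: "1 < q" and q_neq_2: "q \<noteq> 2" and inj_p: "inj_on p V"
    and regular: "completely_regular q V p"
begin

text \<open>Any single test placement with distinct joints gives a lower bound for the rank at
  \<open>p\<close>.\<close>

lemma edge_rank_le_regular:
  assumes "V' \<subseteq> V" "V' \<noteq> {}" "E' \<subseteq> complete_edges V'" "inj_on p' V'"
  shows "edge_rank q p' E' \<le> edge_rank q p E'"
proof -
  have *: "bicoloured_multigraph V' E'" "E' \<subseteq> complete_edges V"
    using assms by (auto simp: bicoloured_multigraph_def complete_edges_def)
  then have "rank (rigidity_matrix q E' p') \<le> rank (rigidity_matrix q E' p)"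
    using regular assms unfolding completely_regular_def subgraph_def framework_def by blast
  then show ?thesis
    using rank_rigidity_matrix[OF q_gt_1 assms(3,4)]
      rank_rigidity_matrix[OF q_gt_1 assms(3) inj_on_subset[OF inj_p assms(1)]] by simp
qed

text \<open>With joint difference \<open>(1, 2)\<close> the two rows are independent. Parallel
  normals at \<open>p\<close> would allow \<open>v\<close> to move alone and leave rank at most
  1.\<close>

lemma cross2_both_colours:
  assumes "v \<in> V" "a \<in> V" "v \<noteq> a"
  shows "cross2 (edge_dir q Blue (p v - p a)) (edge_dir q Red (p v - p a)) \<noteq> 0"
proof
  assume 0: "cross2 (edge_dir q Blue (p v - p a)) (edge_dir q Red (p v - p a)) = 0"
  let ?E = "{(Red, {v, a}), (Blue, {v, a})}"
  let ?p = "(\<lambda>_. vector [0, 0])(v := vector [1, 2])"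
  have "edge_rank q ?p ?E = card ?E"
    by (rule edge_rank_add_two_edges)
      (use assms two_powr_neq_2[OF q_neq_2] in
        \<open>auto simp: vector2_diff edge_dir_vector cross2_vector\<close>)
  then have "2 \<le> edge_rank q p ?E"
    using edge_rank_le_regular[of "{v, a}" ?E ?p] assms by (auto simp: vector2_eq_iff)
  moreover obtain w where w: "edge_dir q Blue (p v - p a) \<bullet> w = 0"
    "edge_dir q Red (p v - p a) \<bullet> w = 0" "w \<noteq> 0"
    using cross2_eq_0_obtain[OF 0] .
  have "int (edge_rank q p ?E) \<le> 2 * int (card {v, a}) - 3"
    by (rule edge_rank_le_of_flex[of _ _ v a _ _ "(\<lambda>_. 0)(v := w)"])
      (use assms w in \<open>auto simp: flex_insert inner_edge_row\<close>)
  ultimately show False using assms by simp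
qed

text \<open>The two edges are completed by both edges between \<open>a\<close> and \<open>b\<close>,
  so that rank 4 is possible on three vertices. A flex moving only \<open>v\<close> would leave rank
  at most 3 at \<open>p\<close>.\<close>

lemma cross2_distinct_neighbours:
  assumes "v \<in> V" "a \<in> V" "b \<in> V" "v \<noteq> a" "v \<noteq> b" "a \<noteq> b"
  shows "cross2 (edge_dir q c (p v - p a)) (edge_dir q d (p v - p b)) \<noteq> 0"
proof
  assume 0: "cross2 (edge_dir q c (p v - p a)) (edge_dir q d (p v - p b)) = 0"
  let ?F = "{(Red, {a, b}), (Blue, {a, b})}"
  let ?E = "insert (d, {v, b}) (insert (c, {v, a}) ?F)"
  \<comment> \<open>Seen from \<open>v\<close> at the origin, \<open>a\<close> and \<open>b\<close>
    lie on different axes, so the normals are not parallel whatever the colours.\<close>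
  let ?p = "(\<lambda>_. vector [0, 0])(a := vector [-1, 0], b := vector [0, -2])"
  have "edge_rank q ?p ?F = card ?F"
    by (rule edge_rank_add_two_edges)
      (use assms two_powr_neq_2[OF q_neq_2] in
        \<open>auto simp: vector2_diff edge_dir_vector cross2_vector\<close>)
  then have "edge_rank q ?p ?E = card ?E"
    by (rule edge_rank_add_two_edges)
      (use assms in \<open>cases d; auto simp: vector2_diff edge_dir_axis cross2_vector edge_dir_vector\<close>)+
  moreover have "edge_rank q ?p ?E \<le> edge_rank q p ?E"
    by (rule edge_rank_le_regular[of "{v, a, b}"])
      (use assms in \<open>auto simp: vector2_eq_iff inj_on_def\<close>)
  moreover have "card ?E = 4"
    using assms by (auto simp: card_insert_if doubleton_eq_iff)
  moreover obtain w where w: "edge_dir q c (p v - p a) \<bullet> w = 0"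
    "edge_dir q d (p v - p b) \<bullet> w = 0" "w \<noteq> 0"
    using cross2_eq_0_obtain[OF 0] .
  have "int (edge_rank q p ?E) \<le> 2 * int (card {v, a, b}) - 3"
    by (rule edge_rank_le_of_flex[of _ _ v a _ _ "(\<lambda>_. 0)(v := w)"])
      (use assms w in \<open>auto simp: flex_insert inner_edge_row\<close>)
  ultimately show False using assms by simp
qed

lemma cross2_edges_neq_0:
  assumes "v \<in> V" "a \<in> V" "b \<in> V" "v \<noteq> a" "v \<noteq> b" "(c, a) \<noteq> (d, b)"
  shows "cross2 (edge_dir q c (p v - p a)) (edge_dir q d (p v - p b)) \<noteq> 0"
proof (cases "a = b")
  case True
  then show ?thesis
    using cross2_both_colours[of v a] assms
    by (cases c; cases d) (auto simp: cross2_commute[of "edge_dir q Red _"] simp del: edge_dir_simps)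
next
  case False
  then show ?thesis using cross2_distinct_neighbours assms by blast
qed

text \<open>The test placement shows rank 6 at \<open>p\<close>, while a flex with different
  velocities at two of the four vertices would force rank at most 5.\<close>

lemma flex_red_K4:
  assumes V: "a \<in> V" "b \<in> V" "c \<in> V" "d \<in> V" and dist: "distinct [a, b, c, d]"
    and E: "E = {(Red, {c, d}), (Red, {b, d}), (Red, {a, d}), (Red, {b, c}), (Red, {a, c}), (Red, {a, b})}"
    and "flex q p E u"
  shows "u a = u b"
proof (rule ccontr)
  assume "u a \<noteq> u b"
  let ?p = "(\<lambda>_. vector [0, 0])(b := vector [1, 0], c := vector [0, 1], d := vector [1, 2])"
  have pv: "?p a = vector [0, 0]" "?p b = vector [1, 0]" "?p c = vector [0, 1]" "?p d = vector [1, 2]"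
    using dist by auto
  let ?s = "(2::real) powr (q - 1)"
  have "edge_rank q ?p {(Red, {b, a})} = card {(Red, {b, a})}"
    by (rule edge_rank_add_edge) (use dist in \<open>auto simp: vector2_eq_iff\<close>)
  then have "edge_rank q ?p {(Red, {c, b}), (Red, {c, a}), (Red, {b, a})} = card {(Red, {c, b}), (Red, {c, a}), (Red, {b, a})}"
    by (rule edge_rank_add_two_edges)
      (use dist in \<open>auto simp: vector2_diff edge_dir_vector cross2_vector\<close>)
  then have "edge_rank q ?p {(Red, {d, b}), (Red, {d, a}), (Red, {c, b}), (Red, {c, a}), (Red, {b, a})}
    = card {(Red, {d, b}), (Red, {d, a}), (Red, {c, b}), (Red, {c, a}), (Red, {b, a})}"
    by (rule edge_rank_add_two_edges)
      (use dist in \<open>auto simp: vector2_diff edge_dir_vector cross2_vector\<close>)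
  \<comment> \<open>A flex of the five edges other than \<open>cd\<close>, fixing \<open>a\<close>.
    On the last edge it takes the value \<open>2 - ?s\<close>, which is nonzero as
    \<open>q \<noteq> 2\<close>.\<close>
  moreover have "flex q ?p {(Red, {d, b}), (Red, {d, a}), (Red, {c, b}), (Red, {c, a}), (Red, {b, a})}
      ((\<lambda>_. vector [0, 0])(b := vector [0, 1], c := vector [-1, 0], d := vector [- ?s, 1]))"
    using dist by (auto simp: flex_insert inner_edge_row vector2_diff edge_dir_vector inner_vector)
  ultimately have "edge_rank q ?p {(Red, {d, c}), (Red, {d, b}), (Red, {d, a}), (Red, {c, b}), (Red, {c, a}), (Red, {b, a})}
    = card {(Red, {d, c}), (Red, {d, b}), (Red, {d, a}), (Red, {c, b}), (Red, {c, a}), (Red, {b, a})}"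
    by (rule edge_rank_insert_indep)
      (use dist two_powr_neq_2[OF q_neq_2] in
        \<open>auto simp: inner_edge_row vector2_diff edge_dir_vector inner_vector\<close>)
  then have "edge_rank q ?p E = 6"
    using dist by (simp add: E insert_commute card_insert_if doubleton_eq_iff)
  moreover have "edge_rank q ?p E \<le> edge_rank q p E"
    by (rule edge_rank_le_regular[of "{a, b, c, d}"])
      (use V dist in \<open>auto simp: E vector2_eq_iff inj_on_def\<close>)
  moreover have "int (edge_rank q p E) \<le> 2 * int (card {a, b, c, d}) - 3"
    by (rule edge_rank_le_of_flex[of _ _ a b _ _ u])
      (use V dist \<open>u a \<noteq> u b\<close> assms(7) in \<open>auto simp: E\<close>)
  ultimately show False using dist by simp
qed

section \<open>Limits as a joint approaches a neighbour\<close>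

text \<open>For small \<open>t\<close> the moved joint differs from all others, and by regularity
  the rank there cannot exceed the deficient rank at \<open>p\<close>.\<close>

lemma eventually_dependent_near:
  assumes "V' \<subseteq> V" "a \<in> V'" "v \<noteq> a" "E \<subseteq> complete_edges V'" "edge_rank q p E \<noteq> card E" "d \<noteq> 0"
  shows "\<forall>\<^sub>F t in at_right 0. edge_rank q (p(v := p a + t *\<^sub>R d)) E \<noteq> card E"
proof -
  have "\<forall>\<^sub>F t in at_right (0::real). p a + t *\<^sub>R d \<noteq> p w" if w: "w \<in> V'" for w
  proof (cases "w = a")
    case True
    show ?thesis
      using assms(6) by (auto simp: True eventually_at_filter)
  next
    case False
    have "((\<lambda>t. p a + t *\<^sub>R d) \<longlongrightarrow> p a + 0 *\<^sub>R d) (at_right (0::real))"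
      by (intro tendsto_intros)
    moreover have "p a \<noteq> p w"
      using False w assms inj_p by (metis inj_onD subsetD)
    ultimately show ?thesis
      by (intro tendsto_imp_eventually_ne) auto
  qed
  then have "\<forall>\<^sub>F t in at_right (0::real). \<forall>w\<in>V'. p a + t *\<^sub>R d \<noteq> p w"
    by (intro eventually_ball_finite) auto
  then show ?thesis
  proof eventually_elim
    case (elim t)
    have "inj_on (p(v := p a + t *\<^sub>R d)) V'"
      using elim inj_on_subset[OF inj_p assms(1)] by (auto simp: inj_on_def)
    then have "edge_rank q (p(v := p a + t *\<^sub>R d)) E \<le> edge_rank q p E"
      using assms by (intro edge_rank_le_regular) auto
    then show ?case
      using assms(5) edge_rank_le_card[of q p E] by linarith
  qed
qed

lemma tendsto_edge_dir:
  "((\<lambda>t. edge_dir q c (x + t *\<^sub>R d - y)) \<longlongrightarrow> edge_dir q c (x - y)) (at_right (0::real))"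
proof (rule isCont_tendsto_compose[OF isCont_edge_dir[OF q_gt_1]])
  have "((\<lambda>t. x + t *\<^sub>R d - y) \<longlongrightarrow> x + 0 *\<^sub>R d - y) (at_right (0::real))"
    by (intro tendsto_intros)
  then show "((\<lambda>t. x + t *\<^sub>R d - y) \<longlongrightarrow> x - y) (at_right (0::real))" by simp
qed

text \<open>
  Let \<open>v\<close> approach \<open>a\<close> in a direction for which the edge \<open>va\<close> acts like the edge \<open>ab\<close> of colour
  \<open>cb\<close>. In the limit the dependence forces every flex of \<open>F\<close> to respect \<open>ab\<close>.
\<close>

lemma flex_limit_three_neighbours:
  assumes V': "V' \<subseteq> V" "a \<in> V'" "b \<in> V'" "d \<in> V'" "distinct [v, a, b, d]"
    and E: "E = insert (ca, {v, a}) (insert (cb, {v, b}) (insert (cd, {v, d}) F))"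
      "E \<subseteq> complete_edges V'" "edge_rank q p E \<noteq> card E"
    and F: "\<And>e. e \<in> F \<Longrightarrow> v \<notin> snd e" "edge_rank q p F = card F" "flex q p F u"
  shows "edge_row q p (cb, {a, b}) \<bullet> flatten u = 0"
proof -
  define n where "n = edge_dir q cb (p a - p b)"
  \<comment> \<open>Approaching \<open>a\<close> along \<open>x\<close>, the edge \<open>va\<close>
    of colour \<open>ca\<close> has the normal of the edge \<open>ab\<close> of colour
    \<open>cb\<close>.\<close>
  obtain x where x: "edge_dir q ca x = n" using edge_dir_surj[OF q_gt_1] .
  have in_V: "a \<in> V" "b \<in> V" "d \<in> V" using V' by auto
  have cr: "cross2 n (edge_dir q cd (p a - p d)) \<noteq> 0"
    unfolding n_def using V'(5) in_V by (intro cross2_distinct_neighbours) auto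
  then have "n \<noteq> 0" by auto
  then have x0: "x \<noteq> 0" using x by auto
  define m where "m = (\<lambda>c y t. edge_dir q c (p a + t *\<^sub>R x - p y))"
  have m: "(m c y \<longlongrightarrow> edge_dir q c (p a - p y)) (at_right 0)" for c y
    unfolding m_def by (rule tendsto_edge_dir)
  have 1: "\<forall>\<^sub>F t in at_right 0. edge_rank q (p(v := p a + t *\<^sub>R x)) E \<noteq> card E"
    using V' E(2,3) x0 by (intro eventually_dependent_near) auto
  have 2: "\<forall>\<^sub>F t in at_right 0. cross2 n (m cd d t) \<noteq> 0"
    using tendsto_imp_eventually_ne[OF tendsto_cross2[OF tendsto_const m] cr] .
  have "\<forall>\<^sub>F t in at_right 0. cross2 n (m cd d t) * (m cb b t \<bullet> (u b - u a))
      = cross2 n (m cb b t) * (m cd d t \<bullet> (u d - u a))"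
    using 1 2 eventually_at_right_less[of "0::real"]
  proof eventually_elim
    case (elim t)
    let ?p = "p(v := p a + t *\<^sub>R x)"
    obtain k where k: "k > 0" "edge_dir q ca (t *\<^sub>R x) = k *\<^sub>R n"
      using edge_dir_scale[OF elim(3)] x by metis
    have dirs: "edge_dir q ca (?p v - ?p a) = k *\<^sub>R n" "edge_dir q cb (?p v - ?p b) = m cb b t"
      "edge_dir q cd (?p v - ?p d) = m cd d t"
      using V'(5) k by (auto simp: m_def)
    have F': "edge_rank q ?p F = card F"
      using edge_rank_update[OF F(1)] F(2) by simp
    have "flex q ?p F (u(v := u v))"
      using flex_update[OF F(1)] F(3) by blast
    then have fl: "flex q ?p F u" by simp
    have "E = insert (cb, {v, b}) (insert (cd, {v, d}) (insert (ca, {v, a}) F))"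
      using E(1) by auto
    then obtain w where "k *\<^sub>R n \<bullet> (w - u a) = 0" "m cd d t \<bullet> (w - u d) = 0" "m cb b t \<bullet> (w - u b) = 0"
      using flex_extends[OF F' F(1) fl, where ?a1.0 = a and ?a2.0 = d and ?a3.0 = b
          and ?c1.0 = ca and ?c2.0 = cd and ?c3.0 = cb and E = E] V'(5) elim k(1)
      unfolding dirs by auto
    \<comment> \<open>The unknown velocity \<open>w\<close> of \<open>v\<close> is eliminated from
      the three edge conditions, taken relative to \<open>u a\<close>.\<close>
    then show ?case
      using k(1) by (intro cross2_consistency[of n "w - u a"]) (auto simp: algebra_simps)
  qed
  then have ev: "\<forall>\<^sub>F t in at_right 0. cross2 n (m cb b t) * (m cd d t \<bullet> (u d - u a))
      = cross2 n (m cd d t) * (m cb b t \<bullet> (u b - u a))"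
    by eventually_elim simp
  have "((\<lambda>t. cross2 n (m cd d t) * (m cb b t \<bullet> (u b - u a))) \<longlongrightarrow>
      cross2 n (edge_dir q cd (p a - p d)) * (n \<bullet> (u b - u a))) (at_right 0)"
    using m[of cb b] m[of cd d] unfolding n_def by (intro tendsto_intros)
  \<comment> \<open>This side tends to 0: the normal of \<open>vb\<close> tends to \<open>n\<close>,
    and \<open>cross2 n n = 0\<close>.\<close>
  moreover have "((\<lambda>t. cross2 n (m cb b t) * (m cd d t \<bullet> (u d - u a))) \<longlongrightarrow>
      cross2 n n * (edge_dir q cd (p a - p d) \<bullet> (u d - u a))) (at_right 0)"
    using m[of cb b] m[of cd d] unfolding n_def by (intro tendsto_intros)
  ultimately have "cross2 n (edge_dir q cd (p a - p d)) * (n \<bullet> (u b - u a))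
      = cross2 n n * (edge_dir q cd (p a - p d) \<bullet> (u d - u a))"
    using ev tendsto_unique[OF trivial_limit_at_right_real] tendsto_cong[OF ev] by blast
  then have "n \<bullet> (u b - u a) = 0" using cr by simp
  then show ?thesis
    using V'(5) by (simp add: inner_edge_row n_def inner_diff_right)
qed

text \<open>Here \<open>v\<close> approaches the other neighbour \<open>b\<close>, along a direction
  that makes \<open>u a - u b\<close> the normal of \<open>vb\<close> up to a factor. A
  contradiction arises already for small \<open>t\<close>.\<close>

lemma flex_limit_double_edge:
  assumes V': "V' \<subseteq> V" "a \<in> V'" "b \<in> V'" "distinct [v, a, b]"
    and E: "E = insert (Blue, {v, a}) (insert (Red, {v, a}) (insert (c, {v, b}) F))"
      "E \<subseteq> complete_edges V'" "edge_rank q p E \<noteq> card E"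
    and F: "\<And>e. e \<in> F \<Longrightarrow> v \<notin> snd e" "edge_rank q p F = card F" "flex q p F u"
  shows "u a = u b"
proof (rule ccontr)
  assume neq: "u a \<noteq> u b"
  obtain x where x: "edge_dir q c x = u a - u b" using edge_dir_surj[OF q_gt_1] .
  have x0: "x \<noteq> 0" using x neq by auto
  define m where "m = (\<lambda>c t. edge_dir q c (p b + t *\<^sub>R x - p a))"
  have m: "(m c \<longlongrightarrow> edge_dir q c (p b - p a)) (at_right 0)" for c
    unfolding m_def by (rule tendsto_edge_dir)
  have cr: "cross2 (edge_dir q Blue (p b - p a)) (edge_dir q Red (p b - p a)) \<noteq> 0"
    using V' by (intro cross2_both_colours) auto
  have 1: "\<forall>\<^sub>F t in at_right 0. edge_rank q (p(v := p b + t *\<^sub>R x)) E \<noteq> card E"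
    using V' E(2,3) x0 by (intro eventually_dependent_near) auto
  have 2: "\<forall>\<^sub>F t in at_right 0. cross2 (m Blue t) (m Red t) \<noteq> 0"
    using tendsto_imp_eventually_ne[OF tendsto_cross2[OF m m] cr] .
  have "\<forall>\<^sub>F t in at_right (0::real). False"
    using 1 2 eventually_at_right_less[of "0::real"]
  proof eventually_elim
    case (elim t)
    let ?p = "p(v := p b + t *\<^sub>R x)"
    obtain k where k: "k > 0" "edge_dir q c (t *\<^sub>R x) = k *\<^sub>R (u a - u b)"
      using edge_dir_scale[OF elim(3)] x by metis
    have dirs: "edge_dir q c (?p v - ?p b) = k *\<^sub>R (u a - u b)" "edge_dir q c' (?p v - ?p a) = m c' t" for c'
      using V'(4) k by (auto simp: m_def)
    have F': "edge_rank q ?p F = card F"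
      using edge_rank_update[OF F(1)] F(2) by simp
    have "flex q ?p F (u(v := u v))"
      using flex_update[OF F(1)] F(3) by blast
    then have fl: "flex q ?p F u" by simp
    have "E = insert (c, {v, b}) (insert (Red, {v, a}) (insert (Blue, {v, a}) F))"
      using E(1) by auto
    then obtain w where w: "m Blue t \<bullet> (w - u a) = 0" "m Red t \<bullet> (w - u a) = 0"
      "k *\<^sub>R (u a - u b) \<bullet> (w - u b) = 0"
      using flex_extends[OF F' F(1) fl, where ?a1.0 = a and ?a2.0 = a and ?a3.0 = b
          and ?c1.0 = Blue and ?c2.0 = Red and ?c3.0 = c and E = E] V'(4) elim
      unfolding dirs by auto
    \<comment> \<open>The double edge forces \<open>v\<close> to move with \<open>a\<close>; the
      edge \<open>vb\<close> then says that \<open>u a - u b\<close> is orthogonal to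
      itself.\<close>
    then have "w - u a = 0" using cross2_eq_0_if_orthogonal elim(2) by blast
    then show ?case using w(3) k(1) neq by simp
  qed
  then show False by simp
qed

end

section \<open>Counting\<close>

definition induced :: "'v edge set \<Rightarrow> 'v set \<Rightarrow> 'v edge set" where
  "induced E U = {e \<in> E. snd e \<subseteq> U}"

definition blue_edges :: "'v edge set \<Rightarrow> 'v edge set" where
  "blue_edges E = {e \<in> E. fst e = Blue}"

text \<open>The two counts, tested on induced edge sets only. The blue count starts at two vertices,
  since its bound is negative for fewer.\<close>

definition mixed_sparse :: "'v::finite edge set \<Rightarrow> bool" where
  "mixed_sparse E \<longleftrightarrow>
     (\<forall>U. U \<noteq> {} \<longrightarrow> int (card (induced E U)) \<le> 2 * int (card U) - 2) \<and>
     (\<forall>U. 2 \<le> card U \<longrightarrow> int (card (induced (blue_edges E) U)) \<le> 2 * int (card U) - 3)"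

text \<open>In a \<open>mixed_sparse\<close> graph the inequality is an equality for nonempty
  \<open>U\<close>. The empty set also satisfies it, so unions below need assumptions on
  intersections.\<close>

definition full :: "'v::finite edge set \<Rightarrow> 'v set \<Rightarrow> bool" where
  "full E U \<longleftrightarrow> 2 * int (card U) - 2 \<le> int (card (induced E U))"

definition blue_full :: "'v::finite edge set \<Rightarrow> 'v set \<Rightarrow> bool" where
  "blue_full E U \<longleftrightarrow> 2 * int (card U) - 3 \<le> int (card (induced (blue_edges E) U))"

text \<open>For two distinct vertices, \<open>tied\<close> blocks a new edge of either colour
  between them, \<open>linked\<close> at least a new blue one.\<close>

definition tied :: "'v::finite edge set \<Rightarrow> 'v set \<Rightarrow> bool" where
  "tied E X \<longleftrightarrow> (\<exists>U. X \<subseteq> U \<and> full E U)"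

definition linked :: "'v::finite edge set \<Rightarrow> 'v set \<Rightarrow> bool" where
  "linked E X \<longleftrightarrow> (\<exists>U. X \<subseteq> U \<and> (full E U \<or> blue_full E U))"

lemma induced_mono: "E \<subseteq> F \<Longrightarrow> U \<subseteq> W \<Longrightarrow> induced E U \<subseteq> induced F W"
  by (auto simp: induced_def)

lemma blue_edges_subset: "blue_edges E \<subseteq> E"
  by (auto simp: blue_edges_def)

lemma blue_edges_mono: "E \<subseteq> F \<Longrightarrow> blue_edges E \<subseteq> blue_edges F"
  by (auto simp: blue_edges_def)

lemma mixed_sparseD:
  assumes "mixed_sparse E"
  shows "U \<noteq> {} \<Longrightarrow> int (card (induced E U)) \<le> 2 * int (card U) - 2"
    "2 \<le> card U \<Longrightarrow> int (card (induced (blue_edges E) U)) \<le> 2 * int (card U) - 3"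
  using assms unfolding mixed_sparse_def by simp_all

lemma mixed_sparse_mono:
  fixes E F :: "'v::finite edge set"
  assumes "mixed_sparse E" "F \<subseteq> E"
  shows "mixed_sparse F"
proof -
  have 1: "int (card (induced F U)) \<le> int (card (induced E U))" for U
    using induced_mono[OF assms(2) order_refl, of U] by (simp add: card_mono)
  have 2: "int (card (induced (blue_edges F) U)) \<le> int (card (induced (blue_edges E) U))" for U
    using induced_mono[OF blue_edges_mono[OF assms(2)] order_refl, of U] by (simp add: card_mono)
  show ?thesis
    unfolding mixed_sparse_def
  proof (intro conjI allI impI)
    fix U :: "'v set" assume "U \<noteq> {}"
    then have "int (card (induced E U)) \<le> 2 * int (card U) - 2"
      using assms(1) unfolding mixed_sparse_def by blast
    with 1[of U] show "int (card (induced F U)) \<le> 2 * int (card U) - 2" by linarith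
  next
    fix U :: "'v set" assume "2 \<le> card U"
    then have "int (card (induced (blue_edges E) U)) \<le> 2 * int (card U) - 3"
      using assms(1) unfolding mixed_sparse_def by blast
    with 2[of U] show "int (card (induced (blue_edges F) U)) \<le> 2 * int (card U) - 3" by linarith
  qed
qed

section \<open>Merging sets that attain a count\<close>

text \<open>Supermodularity of the number of induced edges. A separate \<open>F\<close> allows a
  full set to be combined with a blue full one.\<close>

lemma card_induced_Un_Int:
  fixes E F :: "'v::finite edge set"
  assumes "F \<subseteq> E"
  shows "card (induced E A) + card (induced F B) \<le> card (induced E (A \<union> B)) + card (induced F (A \<inter> B))"
proof -
  have "card (induced E A) + card (induced F B) =
      card (induced E A \<union> induced F B) + card (induced E A \<inter> induced F B)"
    by (rule card_Un_Int) simp_all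
  moreover have "induced E A \<union> induced F B \<subseteq> induced E (A \<union> B)"
    "induced E A \<inter> induced F B \<subseteq> induced F (A \<inter> B)"
    using assms by (auto simp: induced_def)
  then have "card (induced E A \<union> induced F B) \<le> card (induced E (A \<union> B))"
    "card (induced E A \<inter> induced F B) \<le> card (induced F (A \<inter> B))"
    by (simp_all add: card_mono)
  ultimately show ?thesis by linarith
qed

text \<open>The number of vertices is modular and the intersection obeys the upper bound, so the
  union attains the lower one.\<close>

lemma full_Un:
  fixes E :: "'v::finite edge set"
  assumes "mixed_sparse E" "full E A" "full E B" "A \<inter> B \<noteq> {}"
  shows "full E (A \<union> B)"
proof -
  have "int (card (induced E (A \<inter> B))) \<le> 2 * int (card (A \<inter> B)) - 2"
    using assms unfolding mixed_sparse_def by blast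
  then show ?thesis
    using assms(2,3) card_induced_Un_Int[OF order_refl, of E A B] card_Un_Int[OF finite finite, of A B]
    unfolding full_def by linarith
qed

text \<open>The intersection is counted in blue only, and the constants combine as 2 + 3 - 3 =
  2.\<close>

lemma full_blue_full_Un:
  fixes E :: "'v::finite edge set"
  assumes "mixed_sparse E" "full E A" "blue_full E B" "2 \<le> card (A \<inter> B)"
  shows "full E (A \<union> B)"
proof -
  have "int (card (induced (blue_edges E) (A \<inter> B))) \<le> 2 * int (card (A \<inter> B)) - 3"
    using assms unfolding mixed_sparse_def by blast
  then show ?thesis
    using assms(2,3) card_induced_Un_Int[OF blue_edges_subset, of E A B] card_Un_Int[OF finite finite, of A B]
    unfolding full_def blue_full_def by linarith
qed

lemma blue_full_Un:
  fixes E :: "'v::finite edge set"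
  assumes "mixed_sparse E" "blue_full E A" "blue_full E B" "2 \<le> card (A \<inter> B)"
  shows "blue_full E (A \<union> B)"
proof -
  have "int (card (induced (blue_edges E) (A \<inter> B))) \<le> 2 * int (card (A \<inter> B)) - 3"
    using assms unfolding mixed_sparse_def by blast
  then show ?thesis
    using assms(2,3) card_induced_Un_Int[OF order_refl, of "blue_edges E" A B] card_Un_Int[OF finite finite, of A B]
    unfolding blue_full_def by linarith
qed

lemma tied_Un:
  fixes E :: "'v::finite edge set"
  assumes "mixed_sparse E" "tied E X" "tied E Y" "X \<inter> Y \<noteq> {}"
  shows "tied E (X \<union> Y)"
proof -
  obtain A B where "X \<subseteq> A" "full E A" "Y \<subseteq> B" "full E B"
    using assms unfolding tied_def by blast
  moreover from this have "full E (A \<union> B)"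
    using assms by (intro full_Un) auto
  ultimately show ?thesis unfolding tied_def by (intro exI[of _ "A \<union> B"]) auto
qed

text \<open>A vertex outside the full set brings two edges, exactly what the count allows for one
  more vertex.\<close>

lemma tied_insert:
  fixes E :: "'v::finite edge set"
  assumes "tied E X" "a \<in> X" "b \<in> X" "a \<noteq> b" "(c, {a, d}) \<in> E" "(c', {b, d}) \<in> E"
  shows "tied E (insert d X)"
proof -
  obtain U where U: "X \<subseteq> U" "full E U" using assms unfolding tied_def by blast
  have "full E (insert d U)"
  proof (cases "d \<in> U")
    case True
    then show ?thesis using U by (simp add: insert_absorb)
  next
    case False
    have "induced E U \<union> {(c, {a, d}), (c', {b, d})} \<subseteq> induced E (insert d U)"
      using U assms by (auto simp: induced_def)
    then have "card (induced E U \<union> {(c, {a, d}), (c', {b, d})}) \<le> card (induced E (insert d U))"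
      by (simp add: card_mono)
    moreover have "card (induced E U \<union> {(c, {a, d}), (c', {b, d})}) = card (induced E U) + 2"
    proof (subst card_Un_disjoint)
      show "induced E U \<inter> {(c, {a, d}), (c', {b, d})} = {}"
        using False by (auto simp: induced_def)
    qed (use assms False in \<open>auto simp: doubleton_eq_iff card_insert_if\<close>)
    ultimately show ?thesis using U False by (simp add: full_def)
  qed
  then show ?thesis using U unfolding tied_def by (intro exI[of _ "insert d U"]) auto
qed

text \<open>A red edge inside a blue full set supplies the one edge missing to a full set.\<close>

lemma linked_tied:
  fixes E :: "'v::finite edge set"
  assumes "linked E {a, b}" "(Red, {a, b}) \<in> E"
  shows "tied E {a, b}"
proof -
  obtain U where U: "{a, b} \<subseteq> U" "full E U \<or> blue_full E U"
    using assms unfolding linked_def by blast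
  have "insert (Red, {a, b}) (induced (blue_edges E) U) \<subseteq> induced E U"
    using U assms by (auto simp: induced_def blue_edges_def)
  then have "card (insert (Red, {a, b}) (induced (blue_edges E) U)) \<le> card (induced E U)"
    by (simp add: card_mono)
  moreover have "(Red, {a, b}) \<notin> induced (blue_edges E) U"
    by (auto simp: induced_def blue_edges_def)
  ultimately have "full E U" using U by (auto simp: full_def blue_full_def)
  then show ?thesis using U unfolding tied_def by blast
qed

lemma linked_blue_edge:
  fixes E :: "'v::finite edge set"
  assumes "(Blue, {a, b}) \<in> E" "a \<noteq> b"
  shows "linked E {a, b}"
proof -
  have "(Blue, {a, b}) \<in> induced (blue_edges E) {a, b}"
    using assms by (auto simp: induced_def blue_edges_def)
  then have "card (induced (blue_edges E) {a, b}) > 0"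
    by (auto simp: card_gt_0_iff)
  then have "blue_full E {a, b}" using assms(2) by (simp add: blue_full_def)
  then show ?thesis unfolding linked_def by blast
qed

text \<open>One edge raises a count by at most one, and only on sets containing both endpoints; a
  violated count was therefore attained before. The blue count is affected only by a blue
  edge.\<close>

lemma not_mixed_sparse_insert:
  fixes F :: "'v::finite edge set"
  assumes "mixed_sparse F" "\<not> mixed_sparse (insert (c, {a, b}) F)"
  shows "tied F {a, b} \<or> c = Blue \<and> linked F {a, b}"
proof -
  let ?e = "(c, {a, b})"
  consider U where "U \<noteq> {}" "int (card (induced (insert ?e F) U)) > 2 * int (card U) - 2"
    | U where "2 \<le> card U" "int (card (induced (blue_edges (insert ?e F)) U)) > 2 * int (card U) - 3"
    using assms(2) by (auto simp: mixed_sparse_def not_le)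
  then show ?thesis
  proof cases
    case 1
    have F: "int (card (induced F U)) \<le> 2 * int (card U) - 2"
      using assms(1) 1(1) unfolding mixed_sparse_def by blast
    have "{a, b} \<subseteq> U"
    proof (rule ccontr)
      assume "\<not> {a, b} \<subseteq> U"
      then have "induced (insert ?e F) U = induced F U" by (auto simp: induced_def)
      then show False using F 1(2) by simp
    qed
    moreover have "induced (insert ?e F) U \<subseteq> insert ?e (induced F U)"
      by (auto simp: induced_def)
    then have "card (induced (insert ?e F) U) \<le> card (insert ?e (induced F U))"
      by (simp add: card_mono)
    moreover have "\<dots> \<le> Suc (card (induced F U))" by (simp add: card_insert_if)
    ultimately show ?thesis using 1(2) unfolding tied_def full_def by (intro disjI1 exI[of _ U]) auto
  next
    case 2
    have F: "int (card (induced (blue_edges F) U)) \<le> 2 * int (card U) - 3"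
      using assms(1) 2(1) unfolding mixed_sparse_def by blast
    have "{a, b} \<subseteq> U \<and> c = Blue"
    proof (rule ccontr)
      assume "\<not> ({a, b} \<subseteq> U \<and> c = Blue)"
      then have "induced (blue_edges (insert ?e F)) U = induced (blue_edges F) U"
        by (auto simp: induced_def blue_edges_def)
      then show False using F 2(2) by simp
    qed
    moreover have "induced (blue_edges (insert ?e F)) U \<subseteq> insert ?e (induced (blue_edges F) U)"
      by (auto simp: induced_def blue_edges_def)
    then have "card (induced (blue_edges (insert ?e F)) U) \<le> card (insert ?e (induced (blue_edges F) U))"
      by (simp add: card_mono)
    moreover have "\<dots> \<le> Suc (card (induced (blue_edges F) U))" by (simp add: card_insert_if)
    ultimately show ?thesis using 2(2) unfolding linked_def blue_full_def
      by (intro disjI2 conjI exI[of _ U]) auto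
  qed
qed

text \<open>Sets sharing at most one vertex share no induced edge.\<close>

lemma card_three_disjoint:
  fixes E :: "'v::finite edge set"
  assumes "E \<subseteq> complete_edges W" "X \<subseteq> induced E A" "Y \<subseteq> induced E B" "Z \<subseteq> induced E C"
    and "card (A \<inter> B) \<le> 1" "card (A \<inter> C) \<le> 1" "card (B \<inter> C) \<le> 1"
  shows "card X + card Y + card Z = card (X \<union> Y \<union> Z)"
proof -
  have *: "X' \<inter> Y' = {}" if h: "X' \<subseteq> induced E A'" "Y' \<subseteq> induced E B'" "card (A' \<inter> B') \<le> 1" for X' Y' A' B'
  proof (rule ccontr)
    assume "X' \<inter> Y' \<noteq> {}"
    then obtain e where "e \<in> induced E A'" "e \<in> induced E B'"
      using h(1,2) by blast
    then have "e \<in> E" "snd e \<subseteq> A' \<inter> B'"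
      by (auto simp: induced_def)
    moreover from this have "card (snd e) = 2" using assms(1) by (auto simp: complete_edges_def)
    ultimately have "2 \<le> card (A' \<inter> B')" by (metis card_mono finite)
    then show False using h(3) by simp
  qed
  have "X \<inter> Y = {}" "(X \<union> Y) \<inter> Z = {}"
    using *[OF assms(2,3,5)] *[OF assms(2,4,6)] *[OF assms(3,4,7)] by auto
  then show ?thesis by (simp add: card_Un_disjoint)
qed

text \<open>Either two of the three witnessing sets merge and cover the triangle, or they pairwise
  share one vertex only and at most one is full; then all three are joined at once.\<close>

lemma linked_triangle:
  fixes E :: "'v::finite edge set"
  assumes E: "mixed_sparse E" "E \<subseteq> complete_edges W" and dist: "distinct [a, b, d]"
    and "linked E {a, b}" "linked E {a, d}" "linked E {b, d}"
  shows "linked E {a, b, d}"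
proof -
  obtain A B C where A: "a \<in> A" "b \<in> A" "full E A \<or> blue_full E A"
    and B: "a \<in> B" "d \<in> B" "full E B \<or> blue_full E B"
    and C: "b \<in> C" "d \<in> C" "full E C \<or> blue_full E C"
    using assms(4-6) unfolding linked_def by auto
  have pair: ?thesis if "full E X \<or> blue_full E X" "full E Y \<or> blue_full E Y"
    "2 \<le> card (X \<inter> Y) \<or> full E X \<and> full E Y \<and> X \<inter> Y \<noteq> {}" "{a, b, d} \<subseteq> X \<union> Y" for X Y
  proof -
    have ne: "X \<inter> Y \<noteq> {}" using that(3) by auto
    have "full E (X \<union> Y) \<or> blue_full E (X \<union> Y)"
    proof (cases "full E X \<and> full E Y")
      case True
      then show ?thesis using full_Un[OF E(1) _ _ ne] by blast
    next
      case False
      then have 2: "2 \<le> card (X \<inter> Y)" "2 \<le> card (Y \<inter> X)" using that(3) by (auto simp: Int_commute)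
      show ?thesis
        using that(1,2) False full_blue_full_Un[OF E(1) _ _ 2(1)] full_blue_full_Un[OF E(1) _ _ 2(2)]
          blue_full_Un[OF E(1) _ _ 2(1)] by (auto simp: Un_commute)
    qed
    then show ?thesis using that(4) unfolding linked_def by blast
  qed
  show ?thesis
  proof (cases "2 \<le> card (A \<inter> B) \<or> 2 \<le> card (A \<inter> C) \<or> 2 \<le> card (B \<inter> C)
      \<or> full E A \<and> full E B \<or> full E A \<and> full E C \<or> full E B \<and> full E C")
    case True
    then show ?thesis
    proof (elim disjE)
      assume "2 \<le> card (A \<inter> B)" then show ?thesis using A B C by (intro pair[of A B]) auto
    next
      assume "2 \<le> card (A \<inter> C)" then show ?thesis using A B C by (intro pair[of A C]) auto
    next
      assume "2 \<le> card (B \<inter> C)" then show ?thesis using A B C by (intro pair[of B C]) auto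
    next
      assume "full E A \<and> full E B" then show ?thesis using A B C by (intro pair[of A B]) auto
    next
      assume "full E A \<and> full E C" then show ?thesis using A B C by (intro pair[of A C]) auto
    next
      assume "full E B \<and> full E C" then show ?thesis using A B C by (intro pair[of B C]) auto
    qed
  next
    case False
    then have small: "card (A \<inter> B) \<le> 1" "card (A \<inter> C) \<le> 1" "card (B \<inter> C) \<le> 1"
      and one: "\<not> (full E A \<and> full E B)" "\<not> (full E A \<and> full E C)" "\<not> (full E B \<and> full E C)"
      by auto
    have single: "X \<inter> Y = {x}" if "card (X \<inter> Y) \<le> 1" "x \<in> X" "x \<in> Y" for X Y :: "'v set" and x
    proof -
      have "card (X \<inter> Y) \<le> card {x}" using that(1) by simp
      then show ?thesis using that(2,3) card_seteq[of "X \<inter> Y" "{x}"] by simp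
    qed
    have AB: "A \<inter> B = {a}" by (rule single) (use small A B in auto)
    have AC: "A \<inter> C = {b}" by (rule single) (use small A C in auto)
    have BC: "B \<inter> C = {d}" by (rule single) (use small B C in auto)
    have "card (A \<union> B) + 1 = card A + card B"
      using card_Un_Int[OF finite finite, of A B] unfolding AB by simp
    moreover have "(A \<union> B) \<inter> C = {b, d}" using AC BC by auto
    then have "card (A \<union> B \<union> C) + 2 = card (A \<union> B) + card C"
      using card_Un_Int[OF finite finite, of "A \<union> B" C] dist by simp
    \<comment> \<open>Three vertices are counted twice. The loss of 6 in the bound turns the
      constants 3 + 3 + 3 into 3 and 2 + 3 + 3 into 2.\<close>
    ultimately have card: "int (card (A \<union> B \<union> C)) = int (card A) + int (card B) + int (card C) - 3"
      by linarith
    have in_E: "induced (blue_edges E) U \<subseteq> induced E U" for U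
      by (rule induced_mono[OF blue_edges_subset order_refl])
    \<comment> \<open>Here \<open>F\<close> is \<open>E\<close> if one of the sets is full, and the
      blue part of \<open>E\<close> if all are blue full.\<close>
    have sum: "int (card X) + int (card Y) + int (card Z) \<le> int (card (induced F (A \<union> B \<union> C)))"
      if "X \<subseteq> induced E A" "Y \<subseteq> induced E B" "Z \<subseteq> induced E C"
        "X \<subseteq> induced F A" "Y \<subseteq> induced F B" "Z \<subseteq> induced F C" for X Y Z F
    proof -
      have "X \<union> Y \<union> Z \<subseteq> induced F (A \<union> B \<union> C)"
        using that(4-6) by (auto simp: induced_def)
      then have "card (X \<union> Y \<union> Z) \<le> card (induced F (A \<union> B \<union> C))"
        by (intro card_mono) auto
      then show ?thesis
        using card_three_disjoint[OF E(2) that(1-3) small] by linarith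
    qed
    consider "full E A" "blue_full E B" "blue_full E C" | "blue_full E A" "full E B" "blue_full E C"
      | "blue_full E A" "blue_full E B" "full E C" | "blue_full E A" "blue_full E B" "blue_full E C"
      using A(3) B(3) C(3) one by blast
    then have "full E (A \<union> B \<union> C) \<or> blue_full E (A \<union> B \<union> C)"
    proof cases
      case 1
      then have "full E (A \<union> B \<union> C)"
        using sum[OF order_refl in_E in_E order_refl in_E in_E] card unfolding full_def blue_full_def by linarith
      then show ?thesis ..
    next
      case 2
      then have "full E (A \<union> B \<union> C)"
        using sum[OF in_E order_refl in_E in_E order_refl in_E] card unfolding full_def blue_full_def by linarith
      then show ?thesis ..
    next
      case 3
      then have "full E (A \<union> B \<union> C)"
        using sum[OF in_E in_E order_refl in_E in_E order_refl] card unfolding full_def blue_full_def by linarith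
      then show ?thesis ..
    next
      case 4
      then have "blue_full E (A \<union> B \<union> C)"
        using sum[OF in_E in_E in_E order_refl order_refl order_refl] card unfolding blue_full_def by linarith
      then show ?thesis ..
    qed
    then show ?thesis using A B C unfolding linked_def by (intro exI[of _ "A \<union> B \<union> C"]) auto
  qed
qed

lemma tied_imp_linked: "tied E X \<Longrightarrow> linked E X"
  unfolding tied_def linked_def by blast

section \<open>Counts at a vertex of low degree\<close>

text \<open>Adding \<open>v\<close> to a full set of \<open>F\<close> containing \<open>X\<close>
  gains three edges for at most one vertex and exceeds the count.\<close>

lemma not_tied_neighbours:
  fixes E F D :: "'v::finite edge set"
  assumes E: "mixed_sparse E" "E = D \<union> F" "D \<inter> F = {}" "card D = 3"
    and D: "\<And>e. e \<in> D \<Longrightarrow> snd e \<subseteq> insert v X"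
  shows "\<not> tied F X"
proof
  assume "tied F X"
  then obtain U where U: "X \<subseteq> U" "full F U" unfolding tied_def by blast
  have "D \<union> induced F U \<subseteq> induced E (insert v U)"
  proof
    fix e assume "e \<in> D \<union> induced F U"
    then show "e \<in> induced E (insert v U)"
    proof
      assume "e \<in> D"
      then show ?thesis using D[of e] U(1) E(2) by (auto simp: induced_def)
    qed (auto simp: induced_def E(2))
  qed
  then have "card (D \<union> induced F U) \<le> card (induced E (insert v U))" by (intro card_mono) auto
  moreover have "D \<inter> induced F U = {}" using E(3) unfolding induced_def by blast
  then have "card (D \<union> induced F U) = 3 + card (induced F U)"
    using E(4) card_Un_disjoint[OF finite finite] by metis
  moreover have "int (card (induced E (insert v U))) \<le> 2 * int (card (insert v U)) - 2"
    using mixed_sparseD[OF E(1)] by simp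
  moreover have "card (insert v U) \<le> Suc (card U)" by (simp add: card_insert_if)
  ultimately show False using U(2) unfolding full_def by linarith
qed

lemma not_linked_blue_neighbours:
  fixes E F D :: "'v::finite edge set"
  assumes E: "mixed_sparse E" "E = D \<union> F" "D \<inter> F = {}" "card D = 3"
    and D: "\<And>e. e \<in> D \<Longrightarrow> snd e \<subseteq> insert v X" "\<And>e. e \<in> D \<Longrightarrow> fst e = Blue"
    and X: "a \<in> X" "a \<noteq> v"
  shows "\<not> linked F X"
proof
  assume "linked F X"
  then obtain U where U: "X \<subseteq> U" "blue_full F U"
    using not_tied_neighbours[OF E D(1)] unfolding linked_def tied_def by blast
  have "D \<union> induced (blue_edges F) U \<subseteq> induced (blue_edges E) (insert v U)"
  proof
    fix e assume "e \<in> D \<union> induced (blue_edges F) U"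
    then show "e \<in> induced (blue_edges E) (insert v U)"
    proof
      assume "e \<in> D"
      then show ?thesis using D[of e] U(1) E(2) by (auto simp: induced_def blue_edges_def)
    qed (auto simp: induced_def blue_edges_def E(2))
  qed
  then have "card (D \<union> induced (blue_edges F) U) \<le> card (induced (blue_edges E) (insert v U))"
    by (intro card_mono) auto
  moreover have "D \<inter> induced (blue_edges F) U = {}"
    using E(3) unfolding induced_def blue_edges_def by blast
  then have "card (D \<union> induced (blue_edges F) U) = 3 + card (induced (blue_edges F) U)"
    using E(4) card_Un_disjoint[OF finite finite] by metis
  moreover have "2 \<le> card (insert v U)"
    using card_mono[of "insert v U" "{v, a}"] X U(1) by auto
  then have "int (card (induced (blue_edges E) (insert v U))) \<le> 2 * int (card (insert v U)) - 3"
    using mixed_sparseD[OF E(1)] by simp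
  moreover have "card (insert v U) \<le> Suc (card U)" by (simp add: card_insert_if)
  ultimately show False using U(2) unfolding blue_full_def by linarith
qed

text \<open>Handshaking: with all degrees at least four there would be at least
  \<open>2 * card V'\<close> edges.\<close>

lemma exists_vertex_degree_le_3:
  fixes E :: "'v::finite edge set"
  assumes "E \<subseteq> complete_edges V'" "V' \<noteq> {}" "mixed_sparse E"
  obtains v where "v \<in> V'" "card {e \<in> E. v \<in> snd e} \<le> 3"
proof -
  have "\<exists>v\<in>V'. card {e \<in> E. v \<in> snd e} \<le> 3"
  proof (rule ccontr)
    assume neg: "\<not> ?thesis"
    have 4: "4 \<le> card {e \<in> E. v \<in> snd e}" if "v \<in> V'" for v
    proof -
      have "\<not> card {e \<in> E. v \<in> snd e} \<le> 3" using neg that by blast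
      then show ?thesis by simp
    qed
    have "4 * card V' \<le> (\<Sum>v\<in>V'. card {e \<in> E. v \<in> snd e})"
      using sum_mono[of V' "\<lambda>_. 4::nat", OF 4] by (simp add: mult.commute)
    also have "\<dots> = 2 * card E"
    proof (rule sum_multicount)
      show "\<forall>e\<in>E. card {v \<in> V'. v \<in> snd e} = 2"
      proof
        fix e assume "e \<in> E"
        then obtain c a b where "e = (c, {a, b})" "a \<noteq> b" "a \<in> V'" "b \<in> V'"
          using assms(1) complete_edgesE by (metis subsetD)
        then have "{v \<in> V'. v \<in> snd e} = {a, b}" "a \<noteq> b" by auto
        then show "card {v \<in> V'. v \<in> snd e} = 2" by simp
      qed
    qed auto
    finally have "2 * card V' \<le> card E" by simp
    moreover have "induced E V' = E"
      using assms(1) unfolding induced_def subset_iff[of E] complete_edges_iff by blast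
    then have "int (card E) \<le> 2 * int (card V') - 2"
      using mixed_sparseD(1)[OF assms(3,2)] by simp
    ultimately show False by linarith
  qed
  then show ?thesis using that by blast
qed

section \<open>Removing a vertex of degree at most three\<close>

text \<open>The last assumption is the induction hypothesis. It covers every sparse edge set on
  \<open>W\<close>, because it is applied to \<open>F\<close> with an extra edge.\<close>

locale vertex_deletion = regular_placement q V p
  for q :: real and V :: "'v::finite set" and p :: "'v \<Rightarrow> real^2" +
  fixes W :: "'v set" and v :: 'v and F :: "'v edge set"
  assumes W_subset: "W \<subseteq> V" and v_in_V: "v \<in> V" and v_notin_W: "v \<notin> W"
    and F_edges: "F \<subseteq> complete_edges W" and F_sparse: "mixed_sparse F"
    and sparse_indep: "\<And>F'. F' \<subseteq> complete_edges W \<Longrightarrow> mixed_sparse F' \<Longrightarrow> edge_rank q p F' = card F'"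
begin

lemma v_notin_F: "e \<in> F \<Longrightarrow> v \<notin> snd e"
  using F_edges v_notin_W complete_edges_iff by (metis subsetD)

lemma edge_rank_F: "edge_rank q p F = card F"
  using sparse_indep F_edges F_sparse .

lemma new_edge_notin_F: "(c, {v, a}) \<notin> F"
  using v_notin_F by fastforce

text \<open>A new edge respected by all flexes of \<open>F\<close> makes the rows dependent, so by
  the induction hypothesis it breaks a count.\<close>

lemma implied_edge:
  assumes "a \<in> W" "b \<in> W" "a \<noteq> b"
    and "\<And>u. flex q p F u \<Longrightarrow> edge_row q p (c, {a, b}) \<bullet> flatten u = 0"
  shows "(c, {a, b}) \<in> F \<or> tied F {a, b} \<or> c = Blue \<and> linked F {a, b}"
proof (cases "(c, {a, b}) \<in> F")
  case False
  have "edge_rank q p (insert (c, {a, b}) F) = edge_rank q p F"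
    using assms(4) by (simp only: edge_rank_insert) simp
  then have "edge_rank q p (insert (c, {a, b}) F) \<noteq> card (insert (c, {a, b}) F)"
    using False edge_rank_F by simp
  then have "\<not> mixed_sparse (insert (c, {a, b}) F)"
    using sparse_indep[of "insert (c, {a, b}) F"] F_edges assms(1-3) by auto
  then show ?thesis using not_mixed_sparse_insert[OF F_sparse] by blast
qed simp

lemma implied_blue_edge:
  assumes "a \<in> W" "b \<in> W" "a \<noteq> b"
    and "\<And>u. flex q p F u \<Longrightarrow> edge_row q p (Blue, {a, b}) \<bullet> flatten u = 0"
  shows "linked F {a, b}"
  using implied_edge[OF assms] tied_imp_linked linked_blue_edge[of a b F] assms(3) by blast

text \<open>The blue edge gives \<open>linked\<close>. The red edge gives \<open>tied\<close>
  directly, or it lies in \<open>F\<close> and upgrades \<open>linked\<close> to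
  \<open>tied\<close>.\<close>

lemma implied_both_colours:
  assumes "a \<in> W" "b \<in> W" "a \<noteq> b"
    and "\<And>c u. flex q p F u \<Longrightarrow> edge_row q p (c, {a, b}) \<bullet> flatten u = 0"
  shows "tied F {a, b}"
proof -
  have "linked F {a, b}" using implied_blue_edge[OF assms(1-3)] assms(4) by blast
  then show ?thesis
    using implied_edge[OF assms(1-3), of Red] assms(4) linked_tied by blast
qed

text \<open>Dependence would make all three neighbours tied, or linked if the new edges are all
  blue, which the counts at \<open>v\<close> exclude.\<close>

lemma three_neighbours_indep:
  assumes W: "a \<in> W" "b \<in> W" "d \<in> W" and dist: "distinct [a, b, d]"
    and E: "E = insert (ca, {v, a}) (insert (cb, {v, b}) (insert (cd, {v, d}) F))" "mixed_sparse E"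
  shows "edge_rank q p E = card E"
proof (rule ccontr)
  assume dep: "edge_rank q p E \<noteq> card E"
  let ?D = "{(ca, {v, a}), (cb, {v, b}), (cd, {v, d})}"
  have vs: "v \<noteq> a" "v \<noteq> b" "v \<noteq> d" using W v_notin_W by auto
  have E_edges: "E \<subseteq> complete_edges (insert v W)"
    using F_edges W vs unfolding E subset_iff complete_edges_iff by auto
  have V': "insert v W \<subseteq> V" using W_subset v_in_V by simp
  have D: "E = ?D \<union> F" "?D \<inter> F = {}" "card ?D = 3"
    using dist vs new_edge_notin_F by (auto simp: E card_insert_if doubleton_eq_iff)
  have not_tied: "\<not> tied F {a, b, d}"
    by (rule not_tied_neighbours[OF E(2) D, of v]) auto
  \<comment> \<open>Comparing sets of new edges makes the limit lemma available for every ordering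
    of the neighbours.\<close>
  have implied: "edge_row q p (cy, {x, y}) \<bullet> flatten u = 0"
    if "{(cx, {v, x}), (cy, {v, y}), (cz, {v, z})} = ?D" "distinct [x, y, z]" "{x, y, z} \<subseteq> W" "flex q p F u"
    for x y z cx cy cz u
  proof (rule flex_limit_three_neighbours[OF V' _ _ _ _ _ E_edges dep v_notin_F edge_rank_F that(4)])
    show "E = insert (cx, {v, x}) (insert (cy, {v, y}) (insert (cz, {v, z}) F))"
      unfolding D(1) that(1)[symmetric] by simp
  qed (use that(2,3) v_notin_W in auto)
  \<comment> \<open>Letting \<open>v\<close> approach \<open>x\<close> yields the colour
    \<open>cy\<close> on \<open>xy\<close>, letting it approach \<open>y\<close> yields
    \<open>cx\<close>; these are both colours.\<close>
  have tied_differ: "tied F {x, y}"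
    if xyz: "{(cx, {v, x}), (cy, {v, y}), (cz, {v, z})} = ?D" "distinct [x, y, z]" "{x, y, z} \<subseteq> W" and "cx \<noteq> cy"
    for x y z cx cy cz
  proof (rule implied_both_colours)
    fix c u assume u: "flex q p F u"
    have swap: "{(cy, {v, y}), (cx, {v, x}), (cz, {v, z})} = ?D"
      unfolding xyz(1)[symmetric] by (rule insert_commute)
    have "edge_row q p (cy, {x, y}) \<bullet> flatten u = 0"
      by (rule implied[OF xyz u])
    moreover have "edge_row q p (cx, {y, x}) \<bullet> flatten u = 0"
      by (rule implied[OF swap _ _ u]) (use xyz(2,3) in auto)
    moreover have "c = cx \<or> c = cy" using \<open>cx \<noteq> cy\<close> by (cases c; cases cx; cases cy) auto
    ultimately show "edge_row q p (c, {x, y}) \<bullet> flatten u = 0" by (auto simp: insert_commute)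
  qed (use that in auto)
  have perms: "{(ca, {v, a}), (cd, {v, d}), (cb, {v, b})} = ?D" "{(cb, {v, b}), (cd, {v, d}), (ca, {v, a})} = ?D"
    by auto
  have ab_tied: "ca \<noteq> cb \<Longrightarrow> tied F {a, b}"
    using tied_differ[OF refl] W dist by auto
  have ad_tied: "ca \<noteq> cd \<Longrightarrow> tied F {a, d}"
    using tied_differ[OF perms(1)] W dist by auto
  have bd_tied: "cb \<noteq> cd \<Longrightarrow> tied F {b, d}"
    using tied_differ[OF perms(2)] W dist by auto
  have two: False if "tied F X" "tied F Y" "X \<inter> Y \<noteq> {}" "X \<union> Y = {a, b, d}" for X Y
    using tied_Un[OF F_sparse that(1-3)] that(4) not_tied by simp
  have pair: "{a, b} \<union> {a, d} = {a, b, d}" "{a, b} \<union> {b, d} = {a, b, d}" "{a, d} \<union> {b, d} = {a, b, d}"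
    by auto
  have no_two: "\<not> (tied F {a, b} \<and> tied F {a, d})" "\<not> (tied F {a, b} \<and> tied F {b, d})"
    "\<not> (tied F {a, d} \<and> tied F {b, d})"
    using two[OF _ _ _ pair(1)] two[OF _ _ _ pair(2)] two[OF _ _ _ pair(3)] by auto
  \<comment> \<open>If the three colours are not all equal, two of the three pairs differ in colour,
    which gives two tied pairs.\<close>
  then have same: "ca = cb" "ca = cd"
    using ab_tied ad_tied bd_tied by (metis colour.exhaust)+
  have implied_ab: "edge_row q p (ca, {a, b}) \<bullet> flatten u = 0" if "flex q p F u" for u
    using implied[OF refl _ _ that] W dist same by auto
  have implied_ad: "edge_row q p (ca, {a, d}) \<bullet> flatten u = 0" if "flex q p F u" for u
    using implied[OF perms(1) _ _ that] W dist same by auto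
  have implied_bd: "edge_row q p (ca, {b, d}) \<bullet> flatten u = 0" if "flex q p F u" for u
    using implied[OF perms(2) _ _ that] W dist same by auto
  show False
  proof (cases ca)
    case Blue
    have "linked F {a, b}" "linked F {a, d}" "linked F {b, d}"
      using implied_blue_edge implied_ab implied_ad implied_bd W dist Blue by auto
    then have "linked F {a, b, d}"
      by (rule linked_triangle[OF F_sparse F_edges dist])
    moreover have "\<not> linked F {a, b, d}"
      by (rule not_linked_blue_neighbours[OF E(2) D, of v _ a]) (use Blue same vs in auto)
    ultimately show False by blast
  next
    case Red
    have ab: "(Red, {a, b}) \<in> F \<or> tied F {a, b}"
      using implied_edge[of a b Red] implied_ab W dist Red by auto
    have ad: "(Red, {a, d}) \<in> F \<or> tied F {a, d}"
      using implied_edge[of a d Red] implied_ad W dist Red by auto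
    have bd: "(Red, {b, d}) \<in> F \<or> tied F {b, d}"
      using implied_edge[of b d Red] implied_bd W dist Red by auto
    show False
    proof (cases "(Red, {a, b}) \<in> F \<and> (Red, {a, d}) \<in> F \<and> (Red, {b, d}) \<in> F")
      case True
      text \<open>The red \<open>K\<^sub>4\<close> on \<open>v, a, b, d\<close> is rigid, so every flex is constant on it.\<close>
      have const: "u a = u b" "u a = u d" if u: "flex q p F u" for u
      proof -
        have "cross2 (edge_dir q ca (p v - p a)) (edge_dir q cb (p v - p b)) \<noteq> 0"
          using W W_subset v_in_V vs dist by (intro cross2_distinct_neighbours) auto
        moreover have "E = insert (cd, {v, d}) (insert (cb, {v, b}) (insert (ca, {v, a}) F))"
          unfolding E by auto
        ultimately obtain w where w: "flex q p E (u(v := w))"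
          using flex_extends[OF edge_rank_F v_notin_F u vs _ _ dep] by metis
        have in_V: "a \<in> V" "b \<in> V" "d \<in> V" using W W_subset by auto
        have "flex q p {(Red, {d, v}), (Red, {b, v}), (Red, {a, v}), (Red, {b, d}), (Red, {a, d}), (Red, {a, b})} (u(v := w))"
          by (rule flex_subset[OF w]) (use True same Red in \<open>auto simp: E insert_commute\<close>)
        from flex_red_K4[OF in_V v_in_V _ refl this] show "u a = u b" using dist vs by auto
        have "flex q p {(Red, {b, v}), (Red, {d, v}), (Red, {a, v}), (Red, {d, b}), (Red, {a, b}), (Red, {a, d})} (u(v := w))"
          by (rule flex_subset[OF w]) (use True same Red in \<open>auto simp: E insert_commute\<close>)
        from flex_red_K4[OF in_V(1,3,2) v_in_V _ refl this] show "u a = u d" using dist vs by auto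
      qed
      have neq: "a \<noteq> b" "a \<noteq> d" using dist by auto
      \<comment> \<open>Flexes constant on \<open>a\<close>, \<open>b\<close>, \<open>d\<close>
        respect both colours, so two overlapping pairs become tied.\<close>
      have "tied F {a, b}"
      proof (rule implied_both_colours[OF W(1,2) neq(1)])
        fix c u assume "flex q p F u"
        from const(1)[OF this] show "edge_row q p (c, {a, b}) \<bullet> flatten u = 0"
          using neq by (simp add: inner_edge_row)
      qed
      moreover have "tied F {a, d}"
      proof (rule implied_both_colours[OF W(1,3) neq(2)])
        fix c u assume "flex q p F u"
        from const(2)[OF this] show "edge_row q p (c, {a, d}) \<bullet> flatten u = 0"
          using neq by (simp add: inner_edge_row)
      qed
      ultimately show False using no_two by blast
    next
      case False
      \<comment> \<open>Exactly one pair is tied, so the third neighbour is joined to it by two red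
        edges of \<open>F\<close>.\<close>
      then consider "tied F {a, b}" "(Red, {a, d}) \<in> F" "(Red, {b, d}) \<in> F"
        | "tied F {a, d}" "(Red, {a, b}) \<in> F" "(Red, {b, d}) \<in> F"
        | "tied F {b, d}" "(Red, {a, b}) \<in> F" "(Red, {a, d}) \<in> F"
        using ab ad bd no_two by blast
      then have "tied F {a, b, d}"
      proof cases
        case 1
        then show ?thesis
          using tied_insert[of F "{a, b}" a b Red d Red] dist by (simp add: insert_commute)
      next
        case 2
        then show ?thesis
          using tied_insert[of F "{a, d}" a d Red b Red] dist by (simp add: insert_commute)
      next
        case 3
        then show ?thesis
          using tied_insert[of F "{b, d}" b d Red a Red] dist by (simp add: insert_commute)
      qed
      then show False using not_tied by blast
    qed
  qed
qed

text \<open>Dependence would make all flexes of \<open>F\<close> agree at \<open>a\<close> and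
  \<open>b\<close>, tying the only two neighbours of \<open>v\<close>.\<close>

lemma double_edge_indep:
  assumes W: "a \<in> W" "b \<in> W" "a \<noteq> b"
    and E: "E = insert (Blue, {v, a}) (insert (Red, {v, a}) (insert (c, {v, b}) F))" "mixed_sparse E"
  shows "edge_rank q p E = card E"
proof (rule ccontr)
  assume dep: "edge_rank q p E \<noteq> card E"
  let ?D = "{(Blue, {v, a}), (Red, {v, a}), (c, {v, b})}"
  have vs: "v \<noteq> a" "v \<noteq> b" using W v_notin_W by auto
  have E_edges: "E \<subseteq> complete_edges (insert v W)"
    using F_edges W vs unfolding E subset_iff complete_edges_iff by auto
  have V': "insert v W \<subseteq> V" using W_subset v_in_V by simp
  have D: "E = ?D \<union> F" "?D \<inter> F = {}" "card ?D = 3"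
    using W vs new_edge_notin_F by (auto simp: E card_insert_if doubleton_eq_iff)
  have const: "u a = u b" if "flex q p F u" for u
    by (rule flex_limit_double_edge[OF V' _ _ _ E(1) E_edges dep v_notin_F edge_rank_F that])
      (use W vs in auto)
  have "tied F {a, b}"
  proof (rule implied_both_colours[OF W])
    fix c u assume "flex q p F u"
    from const[OF this] show "edge_row q p (c, {a, b}) \<bullet> flatten u = 0"
      using W by (simp add: inner_edge_row)
  qed
  moreover have "\<not> tied F {a, b}"
    by (rule not_tied_neighbours[OF E(2) D, of v]) auto
  ultimately show False by blast
qed

lemma new_vertex_indep:
  assumes D: "D \<subseteq> complete_edges (insert v W)" "\<And>e. e \<in> D \<Longrightarrow> v \<in> snd e" "card D \<le> 3"
    and sparse: "mixed_sparse (D \<union> F)"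
  shows "edge_rank q p (D \<union> F) = card (D \<union> F)"
proof -
  have edge: "\<exists>c a. e = (c, {v, a}) \<and> a \<in> W" if e: "e \<in> D" for e
  proof -
    obtain c x y where "e = (c, {x, y})" "x \<noteq> y" "x \<in> insert v W" "y \<in> insert v W"
      using D(1) e complete_edgesE by (metis subsetD)
    then show ?thesis using D(2)[OF e] by auto
  qed
  have p_neq: "v \<noteq> a" "p v \<noteq> p a" if "a \<in> W" for a
    using that v_notin_W v_in_V W_subset inj_p by (auto dest: inj_onD)
  have cross: "cross2 (edge_dir q c (p v - p a)) (edge_dir q d (p v - p b)) \<noteq> 0"
    if "a \<in> W" "b \<in> W" "(c, a) \<noteq> (d, b)" for a b c d
    using that W_subset v_in_V p_neq by (intro cross2_edges_neq_0) auto
  consider "card D = 0" | "card D = 1" | "card D = 2" | "card D = 3" using D(3) by linarith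
  then show ?thesis
  proof cases
    case 1
    then show ?thesis using edge_rank_F by simp
  next
    case 2
    then obtain c a where "D = {(c, {v, a})}" "a \<in> W"
      using edge by (metis card_1_singletonE insertI1)
    then show ?thesis using edge_rank_add_edge[OF edge_rank_F v_notin_F] p_neq by simp
  next
    case 3
    then obtain e f where ef: "D = {e, f}" "e \<noteq> f" unfolding card_2_iff by blast
    then have "e \<in> D" "f \<in> D" by simp_all
    then obtain c a d b where "e = (c, {v, a})" "a \<in> W" "f = (d, {v, b})" "b \<in> W"
      using edge by meson
    then show ?thesis
      using edge_rank_add_two_edges[OF edge_rank_F v_notin_F _ _ cross, of b a d c] ef p_neq by auto
  next
    case 4
    then obtain e f g where efg: "D = {e, f, g}" "e \<noteq> f" "f \<noteq> g" "e \<noteq> g"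
      unfolding card_3_iff by blast
    then have "e \<in> D" "f \<in> D" "g \<in> D" by simp_all
    then obtain c1 a1 c2 a2 c3 a3 where e: "e = (c1, {v, a1})" "f = (c2, {v, a2})" "g = (c3, {v, a3})"
      and W: "a1 \<in> W" "a2 \<in> W" "a3 \<in> W"
      using edge by meson
    have ne: "(c1, a1) \<noteq> (c2, a2)" "(c2, a2) \<noteq> (c3, a3)" "(c1, a1) \<noteq> (c3, a3)"
      using efg e by auto
    have double: ?thesis
      if "x \<in> W" "y \<in> W" "cx \<noteq> cx'" "D = {(cx, {v, x}), (cx', {v, x}), (cy, {v, y})}" for x y cx cx' cy
    proof -
      have D: "D = {(Blue, {v, x}), (Red, {v, x}), (cy, {v, y})}"
        using that(3,4) by (cases cx; cases cx') auto
      \<comment> \<open>With only two colours, three edges at \<open>v\<close> cannot all go to the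
        same neighbour.\<close>
      have "x \<noteq> y"
      proof
        assume "x = y"
        then have "D = {(Blue, {v, x}), (Red, {v, x})}" using D by (cases cy) auto
        then show False using 4 by simp
      qed
      then show ?thesis
        using double_edge_indep[OF that(1,2), of "D \<union> F" cy] sparse D by simp
    qed
    consider "distinct [a1, a2, a3]" | "a1 = a2" | "a1 = a3" | "a2 = a3" by auto
    then show ?thesis
    proof cases
      case 1
      then show ?thesis
        using three_neighbours_indep[OF W, of "D \<union> F" c1 c2 c3] sparse efg(1) e by simp
    next
      case 2
      then show ?thesis by (intro double[of a1 a3 c1 c2 c3]) (use efg(1) e W ne in auto)
    next
      case 3
      then show ?thesis by (intro double[of a1 a2 c1 c3 c2]) (use efg(1) e W ne in auto)
    next
      case 4
      then show ?thesis by (intro double[of a2 a1 c2 c3 c1]) (use efg(1) e W ne in auto)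
    qed
  qed
qed

end

section \<open>Independence of sparse edge sets and the characterisation\<close>

lemma (in regular_placement) edge_rank_mixed_sparse:
  assumes "V' \<subseteq> V" "E \<subseteq> complete_edges V'" "mixed_sparse E"
  shows "edge_rank q p E = card E"
  using assms
proof (induction "card V'" arbitrary: V' E rule: less_induct)
  case less
  show ?case
  proof (cases "V' = {}")
    case True
    then have "E = {}" using less.prems(2) by (auto simp: complete_edges_def)
    then show ?thesis by simp
  next
    case False
    then obtain v where v: "v \<in> V'" "card {e \<in> E. v \<in> snd e} \<le> 3"
      using exists_vertex_degree_le_3[OF less.prems(2) _ less.prems(3)] by blast
    let ?D = "{e \<in> E. v \<in> snd e}" and ?F = "{e \<in> E. v \<notin> snd e}"
    have E: "?D \<union> ?F = E" by auto
    interpret vertex_deletion q V p "V' - {v}" v ?F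
    proof
      show "V' - {v} \<subseteq> V" "v \<in> V" "v \<notin> V' - {v}" using less.prems v by auto
      show "?F \<subseteq> complete_edges (V' - {v})"
      proof
        fix e assume "e \<in> ?F"
        then have "e \<in> complete_edges V'" "v \<notin> snd e" using less.prems(2) by auto
        then show "e \<in> complete_edges (V' - {v})" by (simp add: complete_edges_iff subset_Diff_insert)
      qed
      show "mixed_sparse ?F" using less.prems(3) by (rule mixed_sparse_mono) auto
      \<comment> \<open>Only \<open>V'\<close> shrinks in the induction; \<open>V\<close> and
        \<open>p\<close> stay fixed, so regularity remains available.\<close>
      show "edge_rank q p F' = card F'" if "F' \<subseteq> complete_edges (V' - {v})" "mixed_sparse F'" for F'
        using card_Diff1_less[OF finite v(1)] less.prems(1) by (intro less.hyps[OF _ _ that]) auto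
    qed
    have "insert v (V' - {v}) = V'" using v(1) by blast
    then have "?D \<subseteq> complete_edges (insert v (V' - {v}))"
      using less.prems(2) by auto
    from new_vertex_indep[OF this _ v(2)] show ?thesis
      using less.prems(3) unfolding E by simp
  qed
qed

text \<open>Since \<open>U\<close> ranges over the whole vertex type, the induced edges are viewed
  as a subgraph on \<open>U \<inter> V\<close>. Empty edge sets, which \<open>sparse2\<close> leaves
  open, meet the bounds trivially.\<close>

lemma mixed_sparse_if_limited:
  fixes E :: "'v::finite edge set"
  assumes "E \<subseteq> complete_edges V" "sparse2 2 V E" "limited_2_3 V E"
  shows "mixed_sparse E"
proof -
  have sub: "subgraph (U \<inter> V) (induced E' U) V E" if "induced E' U \<noteq> {}" "E' \<subseteq> E" for U E'
  proof -
    have *: "e \<in> complete_edges (U \<inter> V) \<and> e \<in> E" if "e \<in> induced E' U" for e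
    proof -
      have "e \<in> E" "snd e \<subseteq> U"
        using that \<open>E' \<subseteq> E\<close> by (auto simp: induced_def)
      moreover from this have "e \<in> complete_edges V" using assms(1) by blast
      ultimately show ?thesis by (simp add: complete_edges_iff)
    qed
    obtain e where e: "e \<in> induced E' U" using \<open>induced E' U \<noteq> {}\<close> by blast
    then have "snd e \<subseteq> U \<inter> V" "card (snd e) = 2"
      using * by (simp_all add: complete_edges_iff)
    then have "U \<inter> V \<noteq> {}" by (metis card.empty subset_empty zero_neq_numeral)
    moreover have "induced E' U \<subseteq> complete_edges (U \<inter> V)" "induced E' U \<subseteq> E"
      using * by blast+
    ultimately show ?thesis
      unfolding subgraph_def bicoloured_multigraph_def by simp
  qed
  have le: "int (card (U \<inter> V)) \<le> int (card U)" for U by (simp add: card_mono)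
  show ?thesis
    unfolding mixed_sparse_def
  proof (intro conjI allI impI)
    fix U :: "'v set" assume "U \<noteq> {}"
    then have "card U > 0" by (simp add: card_gt_0_iff)
    show "int (card (induced E U)) \<le> 2 * int (card U) - 2"
    proof (cases "induced E U = {}")
      case False
      then have "card (induced E U) > 0" by (simp add: card_gt_0_iff)
      then have "int (card (induced E U)) \<le> 2 * int (card (U \<inter> V)) - 2"
        using assms(2)[unfolded sparse2_def, rule_format, OF conjI, OF sub[OF False order_refl]] by simp
      then show ?thesis using le[of U] by linarith
    qed (use \<open>card U > 0\<close> in simp)
  next
    fix U :: "'v set" assume "2 \<le> card U"
    show "int (card (induced (blue_edges E) U)) \<le> 2 * int (card U) - 3"
    proof (cases "induced (blue_edges E) U = {}")
      case False
      let ?B = "induced (blue_edges E) U"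
      have s: "subgraph (U \<inter> V) ?B V E" using sub[OF False blue_edges_subset] .
      moreover have "\<forall>e\<in>?B. fst e = Blue" by (simp add: induced_def blue_edges_def)
      ultimately have "sparse2 3 (U \<inter> V) ?B" using assms(3) unfolding limited_2_3_def by blast
      moreover have "subgraph (U \<inter> V) ?B (U \<inter> V) ?B" using s by (simp add: subgraph_def)
      moreover have "card ?B > 0" using False by (simp add: card_gt_0_iff)
      ultimately have "int (card ?B) \<le> 2 * int (card (U \<inter> V)) - int 3"
        unfolding sparse2_def by blast
      then show ?thesis using le[of U] by simp
    qed (use \<open>2 \<le> card U\<close> in simp)
  qed
qed

theorem theorem4p5:
  fixes q :: real and V :: "'v::finite set" and E :: "'v edge set" and p :: "'v \<Rightarrow> real^2"
  assumes "1 < q" and "q \<noteq> 2"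
    and "framework V E p"
    and "completely_regular q V p"
  shows "minimally_infinitesimally_rigid q V E p \<longleftrightarrow> tight2 2 V E \<and> limited_2_3 V E"
proof -
  have G: "V \<noteq> {}" "E \<subseteq> complete_edges V" "inj_on p V"
    using assms(3) unfolding framework_def bicoloured_multigraph_def by simp_all
  interpret regular_placement q V p
    using assms G by unfold_locales
  have rank: "rank (rigidity_matrix q E' p) = edge_rank q p E'" if "E' \<subseteq> E" for E'
    by (rule rank_rigidity_matrix[OF assms(1) order_trans[OF that G(2)] G(3)])
  show ?thesis
  proof
    assume "minimally_infinitesimally_rigid q V E p"
    then have rigid: "int (edge_rank q p E) = 2 * int (card V) - 2"
      and minimal: "\<And>e. e \<in> E \<Longrightarrow> edge_rank q p (E - {e}) \<noteq> edge_rank q p E"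
      using rank[OF order_refl] rank[OF Diff_subset]
      by (simp_all add: minimally_infinitesimally_rigid_def infinitesimally_rigid_def) metis
    have indep: "edge_rank q p E = card E" by (rule edge_rank_eq_cardI) (rule minimal)
    have "sparse2 2 V E"
      unfolding sparse2_def
    proof (intro allI impI, elim conjE)
      fix V' E' assume "subgraph V' E' V E"
      then have "E' \<subseteq> E" "E' \<subseteq> complete_edges V'" "V' \<noteq> {}"
        unfolding subgraph_def bicoloured_multigraph_def by simp_all
      then show "int (card E') \<le> 2 * int (card V') - int 2"
        using edge_rank_card_subset[OF indep] edge_rank_le[of E' V' q p] by simp
    qed
    moreover have "limited_2_3 V E"
      unfolding limited_2_3_def sparse2_def
    proof (intro allI impI, elim conjE)
      fix V1 E1 V' E' assume sub: "subgraph V1 E1 V E" "\<forall>e\<in>E1. fst e = Blue"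
        "subgraph V' E' V1 E1" "0 < card E'"
      then have E': "E' \<subseteq> E" "E' \<subseteq> complete_edges V'" "V' \<subseteq> V" "E' \<noteq> {}"
        unfolding subgraph_def bicoloured_multigraph_def by (blast, blast, blast, force)
      \<comment> \<open>An edge supplies two vertices with distinct joints, on which the rotation is
        not a translation.\<close>
      then obtain e where "e \<in> complete_edges V'" by blast
      then obtain c v w where "v \<noteq> w" "v \<in> V'" "w \<in> V'"
        by (rule complete_edgesE)
      moreover from this have "p v \<noteq> p w" using E'(3) G(3) by (auto dest: inj_onD)
      moreover have "\<And>e. e \<in> E' \<Longrightarrow> fst e = Blue" using sub(2,3) unfolding subgraph_def by blast
      ultimately show "int (card E') \<le> 2 * int (card V') - int 3"
        using edge_rank_blue_le[OF E'(2), of v w p q] edge_rank_card_subset[OF indep E'(1)] by simp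
    qed
    ultimately show "tight2 2 V E \<and> limited_2_3 V E"
      using rigid indep by (simp add: tight2_def)
  next
    assume "tight2 2 V E \<and> limited_2_3 V E"
    then have "mixed_sparse E" and card: "int (card E) = 2 * int (card V) - 2"
      using mixed_sparse_if_limited[OF G(2)] by (auto simp: tight2_def)
    then have indep: "edge_rank q p E = card E"
      using edge_rank_mixed_sparse[OF order_refl G(2)] by blast
    \<comment> \<open>After a deletion there are fewer rows than the rank required for
      rigidity.\<close>
    have "edge_rank q p (E - {e}) \<noteq> card E" if "e \<in> E" for e
      using edge_rank_le_card[of q p "E - {e}"] card_Diff1_less[OF finite that] by linarith
    then show "minimally_infinitesimally_rigid q V E p"
      using rank[OF order_refl] rank[OF Diff_subset] indep
      by (simp add: minimally_infinitesimally_rigid_def infinitesimally_rigid_def card[symmetric])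
  qed
qed

end
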